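(* Let $n\ge 1$, let $\bar A$ be an $n\times n$ real matrix satisfying $\|\bar A\|_2\le \sqrt n$, and let $A$ be a Gaussian perturbation of $\bar A$ of variance $\sigma^2\le 1$ (with $\sigma>0$). Then for all $x\ge 1$, $$\Pr\left[\kappa(A)\ge x\right]\le \frac{14.1\,n\left(1+\sqrt{2\ln(x)/(9n)}\right)}{x\,\sigma}.$$
   Context: $\|\cdot\|_2$ is the operator norm induced by the Euclidean norm. $\kappa(A)=\|A\|_2\|A^{-1}\|_2$ is the condition number of a square matrix ($A$ is invertible with probability 1). $A$ is a Gaussian perturbation of $\bar A$ of variance $\sigma^2$ if $A=\bar A+G$ where the entries of $G$ are independent univariate Gaussian random variables with mean $0$ and standard deviation $\sigma$. $\ln$ is the natural logarithm. *)

theory Defs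
  imports "HOL-Probability.Probability"
begin

definition spectral_norm :: "real^'n^'m \<Rightarrow> real" where
  "spectral_norm A = onorm (\<lambda>v. A *v v)"

text \<open>If \<open>A\<close> is singular, \<open>matrix_inv A\<close> is an unspecified fixed matrix and the value below
  carries no meaning.\<close>

definition condition_number :: "real^'n^'n \<Rightarrow> real" where
  "condition_number A = spectral_norm A * spectral_norm (matrix_inv A)"

text \<open>The variance is \<open>\<sigma>\<^sup>2\<close>; the parameter is the standard deviation \<open>\<sigma>\<close>, as in
  \<^const>\<open>normal_density\<close>. Independence is joint independence of the family of all entries.\<close>

definition gaussian_perturbation ::
    "'w measure \<Rightarrow> real \<Rightarrow> real^'n^'m \<Rightarrow> ('w \<Rightarrow> real^'n^'m) \<Rightarrow> bool" where
  "gaussian_perturbation M \<sigma> Abar A \<longleftrightarrow>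
    (\<exists>G :: 'w \<Rightarrow> real^'n^'m.
      (\<forall>\<omega>\<in>space M. A \<omega> = Abar + G \<omega>) \<and>
      (\<forall>i j. distributed M lborel (\<lambda>\<omega>. G \<omega> $ i $ j) (normal_density 0 \<sigma>)) \<and>
      prob_space.indep_vars M (\<lambda>_. borel) (\<lambda>(i, j) \<omega>. G \<omega> $ i $ j) UNIV)"

end

theory Submission
  imports Defs
begin

text \<open>
  Write \<open>A = Abar + G\<close>. For a fixed vector \<open>h\<close>, the translates \<open>A + h c\<^sup>T\<close> all map one and the same
  unit vector \<open>t\<close> into the line through \<open>h\<close>, and \<open>norm (A\<inverse> h) \<ge> y\<close> forces an affine function of
  \<open>c \<bullet> t\<close> with slope 1 to be at most \<open>1/y\<close> in absolute value; since the bounded density of a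
  one-dimensional Gaussian controls this, \<open>norm (A\<inverse> h)\<close> has a tail of order \<open>norm h / (y \<sigma>)\<close>.
  For a standard Gaussian \<open>h\<close> independent of \<open>A\<close>, \<open>norm (A\<inverse> h)\<close> is with probability at least
  \<open>1/2\<close> at least a constant times the norm of \<open>A\<inverse>\<close>, while \<open>norm h\<close> has mean at most \<open>sqrt n\<close>.
  Hence the norm of \<open>A\<inverse>\<close> is at least \<open>y\<close> with probability at most \<open>8 sqrt n / (\<pi> y \<sigma>)\<close>. The
  constant \<open>14.1\<close> then leaves room for a crude bound \<open>19/5 sqrt n + 7/4 sqrt (2 ln x)\<close> on the norm
  of \<open>G\<close>, which fails with probability at most \<open>1/x\<close>.
\<close>

section \<open>Gaussian measures on Euclidean spaces\<close>

text \<open>The parameter \<open>p\<close> is the precision: each coordinate has variance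
  \<open>1 / p\<close>. Multiplying Gaussian densities adds precisions, and restricting along a
  linear map that scales squared norms by \<open>\<kappa>\<close> multiplies them by
  \<open>\<kappa>\<close>, which is what the fibre argument below computes with.\<close>

definition gauss_density :: "real \<Rightarrow> 'a::euclidean_space \<Rightarrow> 'a \<Rightarrow> real" where
  "gauss_density p m v = sqrt (p / (2 * pi)) ^ DIM('a) * exp (- (p / 2) * (norm (v - m))\<^sup>2)"

definition gauss :: "real \<Rightarrow> 'a::euclidean_space \<Rightarrow> 'a measure" where
  "gauss p m = density lborel (\<lambda>v. ennreal (gauss_density p m v))"

lemma gauss_density_nonneg [simp]: "0 \<le> p \<Longrightarrow> 0 \<le> gauss_density p m v"
  by (simp add: gauss_density_def)

lemma gauss_density_measurable [measurable]: "gauss_density p m \<in> borel_measurable borel"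
  unfolding gauss_density_def by measurable

lemma sets_gauss [simp, measurable_cong]: "sets (gauss p m) = sets borel"
  by (simp add: gauss_def)

lemma space_gauss [simp]: "space (gauss p m) = UNIV"
  by (simp add: gauss_def)

lemma nn_integral_gauss:
  assumes "f \<in> borel_measurable borel"
  shows "(\<integral>\<^sup>+v. f v \<partial>gauss p m) = (\<integral>\<^sup>+v. ennreal (gauss_density p m v) * f v \<partial>lborel)"
  unfolding gauss_def using assms by (subst nn_integral_density) auto

text \<open>The squared norm is the sum of the squared coordinates over the orthonormal
  \<open>Basis\<close>, so the coordinates are independent. This reduces integrals over the whole
  space to one-dimensional ones.\<close>

lemma gauss_density_eq_prod:
  fixes m v :: "'a::euclidean_space"
  assumes "0 < p"
  shows "gauss_density p m v = (\<Prod>b\<in>Basis. normal_density (m \<bullet> b) (1 / sqrt p) (v \<bullet> b))"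
proof -
  have "normal_density (m \<bullet> b) (1 / sqrt p) (v \<bullet> b)
      = sqrt (p / (2 * pi)) * exp (- (p / 2) * ((v - m) \<bullet> b)\<^sup>2)" for b
    using assms by (simp add: normal_density_def real_sqrt_divide inner_diff_left power_divide field_simps)
  moreover have "(\<Prod>b\<in>Basis. exp (- (p / 2) * ((v - m) \<bullet> b)\<^sup>2)) = exp (- (p / 2) * (norm (v - m))\<^sup>2)"
    by (simp add: exp_sum [symmetric] sum_distrib_left [symmetric] sum_negf sum_divide_distrib [symmetric]
        power2_norm_eq_inner euclidean_inner [of "v - m" "v - m"] power2_eq_square [symmetric])
  ultimately show ?thesis
    by (simp add: gauss_density_def prod.distrib)
qed

lemma prob_space_gauss:
  fixes m :: "'a::euclidean_space"
  assumes p: "0 < p"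
  shows "prob_space (gauss p m)"
proof
  have one: "(\<integral>\<^sup>+x. ennreal (normal_density \<mu> (1 / sqrt p) x) \<partial>lborel) = 1" for \<mu>
    using p by (subst nn_integral_eq_integral) auto
  have "emeasure (gauss p m) (space (gauss p m))
      = (\<integral>\<^sup>+v. (\<Prod>b\<in>Basis. ennreal (normal_density (m \<bullet> b) (1 / sqrt p) (v \<bullet> b))) \<partial>lborel)"
    unfolding gauss_def using p by (subst emeasure_density) (auto simp: gauss_density_eq_prod prod_ennreal)
  also have "\<dots> = 1"
    by (subst nn_integral_lborel_prod) (auto simp: one)
  finally show "emeasure (gauss p m) (space (gauss p m)) = 1" .
qed

lemma nn_integral_gauss_density:
  fixes m :: "'a::euclidean_space"
  assumes "0 < p"
  shows "(\<integral>\<^sup>+v. ennreal (gauss_density p m v) \<partial>lborel) = 1"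
proof -
  have "emeasure (gauss p m) UNIV = 1"
    using prob_space.emeasure_space_1 [OF prob_space_gauss [OF assms, of m]] by simp
  then show ?thesis
    unfolding gauss_def by (subst (asm) emeasure_density) auto
qed

lemma emeasure_gauss_line_le:
  fixes m :: real
  assumes "0 < p" "S \<in> sets borel"
  shows "emeasure (gauss p m) S \<le> ennreal (sqrt (p / (2 * pi))) * emeasure lborel S"
proof -
  have "emeasure (gauss p m) S = (\<integral>\<^sup>+s. ennreal (gauss_density p m s) * indicator S s \<partial>lborel)"
    unfolding gauss_def using assms by (subst emeasure_density) auto
  also have "\<dots> \<le> (\<integral>\<^sup>+s. ennreal (sqrt (p / (2 * pi))) * indicator S s \<partial>lborel)"
    using assms by (intro nn_integral_mono mult_right_mono ennreal_leI)
      (auto simp: gauss_density_def intro!: mult_left_le)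
  also have "\<dots> = ennreal (sqrt (p / (2 * pi))) * emeasure lborel S"
    using assms by (subst nn_integral_cmult_indicator) auto
  finally show ?thesis .
qed

text \<open>Averaging over the translations by \<open>T c\<close>, where \<open>c\<close> has density proportional to
  \<open>exp (- \<epsilon> / 2 * norm c ^ 2)\<close>, turns the Gaussian on the big space into a mixture of Gaussians
  of precision \<open>\<epsilon> + \<kappa> p\<close> along the fibres \<open>x + range T\<close>; then \<open>\<epsilon>\<close> tends to \<open>0\<close>.\<close>

lemma emeasure_gauss_fibre_le:
  fixes T :: "'b::euclidean_space \<Rightarrow> 'a::euclidean_space"
  assumes T: "linear T" and nT: "\<And>c. (norm (T c))\<^sup>2 = \<kappa> * (norm c)\<^sup>2"
    and \<kappa>: "0 \<le> \<kappa>" and p: "0 < p" and L: "0 \<le> L"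
    and S [measurable]: "S \<in> sets borel"
    and fib: "\<And>P x m. 0 < P \<Longrightarrow> emeasure (gauss P m) {c. x + T c \<in> S} \<le> ennreal (L * sqrt P)"
  shows "emeasure (gauss p m) S \<le> ennreal (L * sqrt (\<kappa> * p))"
proof -
  interpret E: prob_space "gauss p m" by (rule prob_space_gauss [OF p])
  have Tm [measurable]: "T \<in> borel_measurable borel"
    using T by (intro borel_measurable_continuous_onI linear_continuous_on linear_conv_bounded_linear [THEN iffD1])
  have bound: "emeasure (gauss p m) S \<le> ennreal (L * sqrt (\<epsilon> + \<kappa> * p))" if e: "0 < \<epsilon>" for \<epsilon>
  proof -
    define P where "P = \<epsilon> + \<kappa> * p"
    have P: "0 < P" using e \<kappa> p by (simp add: P_def add_pos_nonneg)
    define g where "g c = gauss_density \<epsilon> (0::'b) c" for c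
    define f where "f x = gauss_density p m x" for x
    have [measurable]: "g \<in> borel_measurable borel" "f \<in> borel_measurable borel"
      by (auto simp: g_def [abs_def] f_def [abs_def])
    have f0: "0 \<le> f x" and g0: "0 \<le> g c" for x c using e p by (auto simp: f_def g_def)
    \<comment> \<open>In \<open>c\<close>, the exponent of \<open>g c * f (x + T c)\<close> has
      quadratic part \<open>- (P / 2) * (norm c)\<^sup>2\<close> and linear part
      \<open>- p * (T c \<bullet> (x - m))\<close>; completing the square puts the centre here. The
      remaining factor depends on \<open>x\<close> only.\<close>
    define \<mu> where "\<mu> x = - (p / P) *\<^sub>R adjoint T (x - m)" for x
    have "\<exists>K\<ge>0. \<forall>c. g c * f (x + T c) = K * gauss_density P (\<mu> x) c" for x
    proof -
      define w where "w = x - m"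
      have inn: "c \<bullet> adjoint T w = T c \<bullet> w" for c by (rule adjoint_works [OF T])
      have sq: "- (\<epsilon> / 2) * (norm c)\<^sup>2 - (p / 2) * (norm (x + T c - m))\<^sup>2
          = - (P / 2) * (norm (c - \<mu> x))\<^sup>2 + (p\<^sup>2 / (2 * P) * (norm (adjoint T w))\<^sup>2 - (p / 2) * (norm w)\<^sup>2)" for c
      proof -
        have 1: "(norm (x + T c - m))\<^sup>2 = (norm w)\<^sup>2 + 2 * (T c \<bullet> w) + \<kappa> * (norm c)\<^sup>2"
          using nT [of c] by (simp add: w_def power2_norm_eq_inner inner_simps inner_commute algebra_simps)
        have 2: "(norm (c - \<mu> x))\<^sup>2 = (norm c)\<^sup>2 + 2 * (p / P) * (T c \<bullet> w) + (p / P)\<^sup>2 * (norm (adjoint T w))\<^sup>2"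
          unfolding \<mu>_def w_def [symmetric] inn [symmetric] power2_norm_eq_inner
          by (simp add: inner_simps inner_commute algebra_simps power2_eq_square)
        have 3: "- (\<epsilon> / 2) * a - (p / 2) * (e + 2 * b + \<kappa> * a)
            = - (P / 2) * (a + 2 * (p / P) * b + (p / P)\<^sup>2 * d) + (p\<^sup>2 / (2 * P) * d - (p / 2) * e)"
          for a b d e :: real
        proof -
          have eps: "\<epsilon> = P - \<kappa> * p" by (simp add: P_def)
          show ?thesis unfolding eps using P by (simp add: field_simps power2_eq_square)
        qed
        show ?thesis unfolding 1 2 by (rule 3)
      qed
      have ex: "exp (- (\<epsilon> / 2) * (norm c)\<^sup>2) * exp (- (p / 2) * (norm (x + T c - m))\<^sup>2)
          = exp (- (P / 2) * (norm (c - \<mu> x))\<^sup>2) * exp (p\<^sup>2 / (2 * P) * (norm (adjoint T w))\<^sup>2 - (p / 2) * (norm w)\<^sup>2)" for c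
        unfolding exp_add [symmetric] using sq [of c] by simp
      define K where "K = sqrt (\<epsilon> / (2 * pi)) ^ DIM('b) * sqrt (p / (2 * pi)) ^ DIM('a)
        * exp (p\<^sup>2 / (2 * P) * (norm (adjoint T w))\<^sup>2 - (p / 2) * (norm w)\<^sup>2) / sqrt (P / (2 * pi)) ^ DIM('b)"
      have "g c * f (x + T c) = K * gauss_density P (\<mu> x) c" for c
        using ex [of c] P by (simp add: g_def f_def gauss_density_def K_def field_simps)
      moreover have "0 \<le> K" using e p P by (simp add: K_def)
      ultimately show ?thesis by blast
    qed
    then obtain K where K0: "\<And>x. 0 \<le> K x"
      and K: "\<And>x c. g c * f (x + T c) = K x * gauss_density P (\<mu> x) c" by metis
    \<comment> \<open>Integrating over \<open>x\<close> first, the shift by \<open>T c\<close>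
      disappears by translation invariance of Lebesgue measure, and then \<open>g\<close> integrates
      to 1.\<close>
    have Q: "(\<integral>\<^sup>+x. \<integral>\<^sup>+c. ennreal (g c * f (x + T c)) * indicator A (x + T c) \<partial>lborel \<partial>lborel)
        = emeasure (gauss p m) A" if [measurable]: "A \<in> sets borel" for A
    proof -
      have "(\<integral>\<^sup>+x. \<integral>\<^sup>+c. ennreal (g c * f (x + T c)) * indicator A (x + T c) \<partial>lborel \<partial>lborel)
          = (\<integral>\<^sup>+c. \<integral>\<^sup>+x. ennreal (g c) * (ennreal (f (x + T c)) * indicator A (x + T c)) \<partial>lborel \<partial>lborel)"
        by (subst lborel_pair.Fubini') (auto simp: ennreal_mult f0 g0 mult.assoc)
      also have "\<dots> = (\<integral>\<^sup>+c. ennreal (g c) * emeasure (gauss p m) A \<partial>lborel)"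
      proof (rule nn_integral_cong)
        fix c
        have "(\<integral>\<^sup>+x. ennreal (g c) * (ennreal (f (x + T c)) * indicator A (x + T c)) \<partial>lborel)
            = ennreal (g c) * (\<integral>\<^sup>+x. ennreal (f (T c + x)) * indicator A (T c + x) \<partial>lborel)"
          by (subst nn_integral_cmult) (auto simp: add.commute)
        also have "(\<integral>\<^sup>+x. ennreal (f (T c + x)) * indicator A (T c + x) \<partial>lborel)
            = (\<integral>\<^sup>+x. ennreal (f x) * indicator A x \<partial>(distr lborel borel ((+) (T c))))"
          by (subst nn_integral_distr) auto
        also have "\<dots> = emeasure (gauss p m) A"
          by (simp add: lborel_distr_plus gauss_def f_def emeasure_density)
        finally show "(\<integral>\<^sup>+x. ennreal (g c) * (ennreal (f (x + T c)) * indicator A (x + T c)) \<partial>lborel)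
            = ennreal (g c) * emeasure (gauss p m) A" .
      qed
      also have "\<dots> = emeasure (gauss p m) A"
        using nn_integral_gauss_density [OF e, of "0::'b"] by (subst nn_integral_multc) (auto simp: g_def)
      finally show ?thesis .
    qed
    have KG: "(\<integral>\<^sup>+c. ennreal (g c * f (x + T c)) * indicator A (x + T c) \<partial>lborel)
        = ennreal (K x) * emeasure (gauss P (\<mu> x)) {c. x + T c \<in> A}" if [measurable]: "A \<in> sets borel" for A x
    proof -
      have "(\<integral>\<^sup>+c. ennreal (g c * f (x + T c)) * indicator A (x + T c) \<partial>lborel)
          = (\<integral>\<^sup>+c. ennreal (K x) * (ennreal (gauss_density P (\<mu> x) c) * indicator {c. x + T c \<in> A} c) \<partial>lborel)"
        using P by (intro nn_integral_cong) (auto simp: K ennreal_mult K0 mult.assoc split: split_indicator)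
      also have "\<dots> = ennreal (K x) * emeasure (gauss P (\<mu> x)) {c. x + T c \<in> A}"
        by (subst nn_integral_cmult) (auto simp: gauss_def emeasure_density)
      finally show ?thesis .
    qed
    have "emeasure (gauss p m) S
        = (\<integral>\<^sup>+x. ennreal (K x) * emeasure (gauss P (\<mu> x)) {c. x + T c \<in> S} \<partial>lborel)"
      by (simp add: Q [symmetric] KG)
    \<comment> \<open>The weight \<open>K x\<close> is the inner integral of \<open>KG\<close> for
      the set \<open>UNIV\<close>. Written in that form, the weights integrate by \<open>Q\<close>
      to the total mass 1.\<close>
    also have "\<dots> \<le> (\<integral>\<^sup>+x. ennreal (L * sqrt P) * (\<integral>\<^sup>+c. ennreal (g c * f (x + T c)) * indicator UNIV (x + T c) \<partial>lborel) \<partial>lborel)"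
    proof (rule nn_integral_mono)
      fix x
      interpret F: prob_space "gauss P (\<mu> x)" by (rule prob_space_gauss [OF P])
      have "emeasure (gauss P (\<mu> x)) UNIV = 1" using F.emeasure_space_1 by simp
      then show "ennreal (K x) * emeasure (gauss P (\<mu> x)) {c. x + T c \<in> S}
          \<le> ennreal (L * sqrt P) * (\<integral>\<^sup>+c. ennreal (g c * f (x + T c)) * indicator UNIV (x + T c) \<partial>lborel)"
        using fib [OF P, of "\<mu> x" x] by (subst KG) (auto simp: mult.commute intro!: mult_left_mono)
    qed
    also have "\<dots> = ennreal (L * sqrt P) * emeasure (gauss p m) UNIV"
      using Q [of UNIV] by (subst nn_integral_cmult) auto
    also have "\<dots> = ennreal (L * sqrt P)"
      using E.emeasure_space_1 by simp
    finally show ?thesis by (simp add: P_def)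
  qed
  have "((\<lambda>\<epsilon>. ennreal (L * sqrt (\<epsilon> + \<kappa> * p))) \<longlongrightarrow> ennreal (L * sqrt (0 + \<kappa> * p))) (at_right 0)"
    by (intro tendsto_intros)
  moreover have "\<forall>\<^sub>F \<epsilon> in at_right 0. emeasure (gauss p m) S \<le> ennreal (L * sqrt (\<epsilon> + \<kappa> * p))"
    using bound by (auto simp: eventually_at_right_less eventually_at_filter intro!: always_eventually)
  ultimately show ?thesis
    using tendsto_lowerbound [of _ _ "at_right (0::real)" "emeasure (gauss p m) S"] by simp
qed

text \<open>The fibres are the lines in direction \<open>u\<close>, so \<open>\<kappa> = 1\<close>,
  and on each line the density is at most \<open>sqrt (P / (2 * pi))\<close>. The lemma serves both
  for slabs, where \<open>l\<close> is the width, and for null sets, where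
  \<open>l = 0\<close>.\<close>

lemma emeasure_gauss_line_sections_le:
  fixes u :: "'a::euclidean_space"
  assumes u: "norm u = 1" and p: "0 < p" and l: "0 \<le> l"
    and S [measurable]: "S \<in> sets borel"
    and sec: "\<And>v. emeasure lborel {s. v + s *\<^sub>R u \<in> S} \<le> ennreal l"
  shows "emeasure (gauss p m) S \<le> ennreal (l * sqrt (p / (2 * pi)))"
proof -
  have "emeasure (gauss p m) S \<le> ennreal (l / sqrt (2 * pi) * sqrt (1 * p))"
  proof (rule emeasure_gauss_fibre_le [where T = "\<lambda>s. s *\<^sub>R u"])
    fix P m :: real and x
    assume P: "0 < P"
    have "emeasure (gauss P m) {s. x + s *\<^sub>R u \<in> S}
        \<le> ennreal (sqrt (P / (2 * pi))) * emeasure lborel {s. x + s *\<^sub>R u \<in> S}"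
      by (rule emeasure_gauss_line_le [OF P]) measurable
    also have "\<dots> \<le> ennreal (sqrt (P / (2 * pi))) * ennreal l"
      by (intro mult_left_mono sec) auto
    also have "\<dots> = ennreal (l / sqrt (2 * pi) * sqrt P)"
      using P l by (simp add: ennreal_mult [symmetric] real_sqrt_divide mult.commute)
    finally show "emeasure (gauss P m) {s. x + s *\<^sub>R u \<in> S} \<le> ennreal (l / sqrt (2 * pi) * sqrt P)" .
  qed (use u p l in \<open>auto intro!: linearI simp: scaleR_add_left\<close>)
  then show ?thesis by (simp add: real_sqrt_divide)
qed

section \<open>Singular matrices and the inverse applied to a fixed vector\<close>

definition outer :: "real^'m \<Rightarrow> real^'n \<Rightarrow> real^'n^'m" where
  "outer h c = (\<chi> i j. h $ i * c $ j)"

lemma outer_mult_vec: "outer h c *v v = (c \<bullet> v) *\<^sub>R h"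
  by (simp add: vec_eq_iff outer_def matrix_vector_mult_def inner_vec_def sum_distrib_left mult_ac)

text \<open>The inner product of matrices is the entrywise one, so the bilinear form of
  \<open>G\<close> at \<open>h\<close> and \<open>c\<close> is a linear functional of
  \<open>G\<close>, represented by a rank-one matrix.\<close>

lemma inner_outer: "G \<bullet> outer h c = h \<bullet> (G *v c)"
  by (simp add: outer_def matrix_vector_mult_def inner_vec_def sum_distrib_left mult_ac)

lemma norm_outer: "(norm (outer h c))\<^sup>2 = (norm h)\<^sup>2 * (norm c)\<^sup>2"
  unfolding power2_norm_eq_inner by (simp add: inner_outer outer_mult_vec)

lemma linear_outer: "linear (outer h)"
  by (rule linearI) (simp_all add: outer_def vec_eq_iff algebra_simps)

lemma continuous_on_det [continuous_intros]:
  fixes f :: "'a::topological_space \<Rightarrow> real^'n^'n"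
  assumes "continuous_on S f"
  shows "continuous_on S (\<lambda>x. det (f x))"
  unfolding det_def using assms by (intro continuous_intros)

lemma det_measurable [measurable]: "det \<in> borel_measurable (borel :: (real^'n^'n) measure)"
  by (intro borel_measurable_continuous_onI continuous_intros)

lemma det_eq_0_iff_ker:
  fixes A :: "real^'n^'n"
  shows "det A = 0 \<longleftrightarrow> (\<exists>x. x \<noteq> 0 \<and> A *v x = 0)"
proof -
  have "det A \<noteq> 0 \<longleftrightarrow> (\<exists>B. B ** A = mat 1)"
    by (simp add: invertible_det_nz [symmetric] invertible_left_inverse)
  also have "\<dots> \<longleftrightarrow> (\<forall>x. A *v x = 0 \<longrightarrow> x = 0)"
    by (rule matrix_left_invertible_ker)
  finally show ?thesis by blast
qed

text \<open>The determinant is a polynomial in \<open>s\<close>, namely \<open>det Q\<close> for a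
  matrix of linear polynomials. It is not the zero polynomial: for \<open>s\<close> above the
  operator norm of \<open>A\<close>, the equation \<open>A *v x = - s *\<^sub>R x\<close> has only
  the zero solution.\<close>

lemma finite_real_eigenvalues:
  fixes A :: "real^'n^'n"
  shows "finite {s. det (A + s *\<^sub>R mat 1) = 0}"
proof -
  define Q :: "real poly^'n^'n" where "Q = (\<chi> i j. [:A $ i $ j, mat 1 $ i $ j:])"
  have poly: "poly (det Q) s = det (A + s *\<^sub>R mat 1)" for s
    unfolding det_def Q_def by (simp add: poly_sum poly_prod)
  define s where "s = onorm ((*v) A) + 1"
  have bl: "bounded_linear ((*v) A)" by simp
  have "x = 0" if "(A + s *\<^sub>R mat 1) *v x = 0" for x
  proof -
    have "A *v x = - s *\<^sub>R x"
      using that by (simp add: matrix_vector_mult_add_rdistrib scaleR_matrix_vector_assoc [symmetric] eq_neg_iff_add_eq_0)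
    then have "\<bar>s\<bar> * norm x \<le> onorm ((*v) A) * norm x"
      using onorm [OF bl, of x] by simp
    moreover have "0 \<le> onorm ((*v) A)" by (rule onorm_pos_le [OF bl])
    ultimately have "norm x \<le> 0" by (simp add: s_def algebra_simps)
    then show "x = 0" by simp
  qed
  then have "det (A + s *\<^sub>R mat 1) \<noteq> 0"
    by (auto simp: det_eq_0_iff_ker)
  then have "det Q \<noteq> 0" using poly [of s] by auto
  then show ?thesis using poly_roots_finite [of "det Q"] by (simp add: poly)
qed

text \<open>Every line in the direction of the identity matrix meets the singular matrices in
  finitely many points, so all sections have length 0.\<close>

lemma singular_null:
  fixes B :: "real^'n^'n"
  assumes p: "0 < p"
  shows "emeasure (gauss p m) {G. det (B + G) = 0} = 0"
proof -
  define k where "k = norm (mat 1 :: real^'n^'n)"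
  have k: "0 < k"
    unfolding k_def by (auto simp: vec_eq_iff mat_def)
  have "emeasure (gauss p m) {G. det (B + G) = 0} \<le> ennreal (0 * sqrt (p / (2 * pi)))"
  \<comment> \<open>The identity matrix is divided by its norm \<open>k\<close> to give a unit
    direction; this only rescales the finite set of parameters by \<open>k\<close>.\<close>
  proof (rule emeasure_gauss_line_sections_le [where u = "(1 / k) *\<^sub>R mat 1", OF _ p])
    fix V :: "real^'n^'n"
    have "{s. V + s *\<^sub>R (1 / k) *\<^sub>R mat 1 \<in> {G. det (B + G) = 0}}
        = (\<lambda>s. k * s) ` {s. det ((B + V) + s *\<^sub>R mat 1) = 0}" (is "?L = ?R")
    proof
      show "?L \<subseteq> ?R"
      proof
        fix s assume "s \<in> ?L"
        then have "s / k \<in> {s. det ((B + V) + s *\<^sub>R mat 1) = 0}" by (simp add: add.assoc)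
        moreover have "s = k * (s / k)" using k by simp
        ultimately show "s \<in> ?R" by blast
      qed
      show "?R \<subseteq> ?L" using k by (auto simp: add.assoc)
    qed
    then have "finite {s. V + s *\<^sub>R (1 / k) *\<^sub>R mat 1 \<in> {G. det (B + G) = 0}}"
      using finite_real_eigenvalues [of "B + V"] by simp
    then show "emeasure lborel {s. V + s *\<^sub>R (1 / k) *\<^sub>R mat 1 \<in> {G. det (B + G) = 0}} \<le> ennreal 0"
      by (simp add: emeasure_lborel_countable countable_finite)
  next
    show "{G. det (B + G) = 0} \<in> sets borel" by measurable
  qed (use k in \<open>simp_all add: k_def\<close>)
  then show ?thesis by simp
qed

text \<open>For nonsingular \<open>A\<close> this is \<open>matrix_inv A *v h\<close>, written with
  determinants so that joint Borel measurability in \<open>A\<close> and \<open>h\<close> can be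
  read off. For singular \<open>A\<close>, division by zero makes it the zero vector.\<close>

definition cramer_solution :: "real^'n^'n \<Rightarrow> real^'n \<Rightarrow> real^'n" where
  "cramer_solution A h = (\<chi> k. det (\<chi> i j. if j = k then h $ i else A $ i $ j) / det A)"

lemma cramer_solution_eq:
  assumes "det A \<noteq> 0"
  shows "A *v cramer_solution A h = h" "cramer_solution A h = matrix_inv A *v h"
proof -
  show *: "A *v cramer_solution A h = h"
    using cramer [OF assms, of "cramer_solution A h" h] by (simp add: cramer_solution_def)
  have "\<exists>A'. A ** A' = mat 1 \<and> A' ** A = mat 1"
    using assms invertible_det_nz [of A] by (simp add: invertible_def)
  then have "matrix_inv A ** A = mat 1"
    unfolding matrix_inv_def by (rule someI2_ex) simp
  then show "cramer_solution A h = matrix_inv A *v h"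
    using * by (metis matrix_vector_mul_assoc matrix_vector_mul_lid)
qed

lemma cramer_solution_measurable:
  "(\<lambda>(A, h). cramer_solution A h) \<in> borel_measurable (borel :: ((real^'n^'n) \<times> (real^'n)) measure)"
proof -
  have 1: "(\<lambda>z. det (\<chi> i j. if j = k then snd z $ i else fst z $ i $ j))
      \<in> borel_measurable (borel :: ((real^'n^'n) \<times> (real^'n)) measure)" for k
  proof (intro borel_measurable_continuous_onI continuous_on_det continuous_on_vec_lambda)
    fix i j
    show "continuous_on UNIV (\<lambda>z :: (real^'n^'n) \<times> (real^'n). if j = k then snd z $ i else fst z $ i $ j)"
      by (cases "j = k") (auto intro!: continuous_intros)
  qed
  have 2: "(\<lambda>z. det (fst z)) \<in> borel_measurable (borel :: ((real^'n^'n) \<times> (real^'n)) measure)"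
    by (intro borel_measurable_continuous_onI continuous_intros)
  have "(\<lambda>z. (\<chi> k. det (\<chi> i j. if j = k then snd z $ i else fst z $ i $ j) / det (fst z)) :: real^'n)
      \<in> borel_measurable (borel :: ((real^'n^'n) \<times> (real^'n)) measure)"
    using 1 2 by (subst borel_measurable_euclidean_space) 
      (auto simp: Basis_vec_def inner_axis intro!: borel_measurable_divide)
  then show ?thesis
    by (simp add: cramer_solution_def case_prod_unfold)
qed

text \<open>The fibre bound is used with \<open>T = outer h\<close>, whose scaling factor is
  \<open>(norm h)\<^sup>2\<close>. On each fibre the event lies in a slab of width
  \<open>2 / y\<close> in the variable \<open>c\<close>, and the slab bound gives
  \<open>L = 2 / y / sqrt (2 * pi)\<close>.\<close>

lemma emeasure_inverse_vector_le:
  fixes B :: "real^'n^'n" and h :: "real^'n"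
  assumes p: "0 < p" and y: "0 < y"
  shows "emeasure (gauss p 0) {G. det (B + G) \<noteq> 0 \<and> y \<le> norm (cramer_solution (B + G) h)}
    \<le> ennreal (2 * norm h / y * sqrt (p / (2 * pi)))"
proof (cases "h = 0")
  case True
  then have *: "{G. det (B + G) \<noteq> 0 \<and> y \<le> norm (cramer_solution (B + G) h)} = {}"
    using y by (auto simp: cramer_solution_eq(2))
  show ?thesis unfolding * by simp
next
  case h: False
  let ?S = "{G. det (B + G) \<noteq> 0 \<and> y \<le> norm (cramer_solution (B + G) h)}"
  have cm [measurable]: "(\<lambda>G. cramer_solution (B + G) h) \<in> borel_measurable borel"
  proof -
    have "(\<lambda>G. (B + G, h)) \<in> borel_measurable borel"
      by (intro borel_measurable_continuous_onI continuous_intros)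
    from measurable_compose [OF this cramer_solution_measurable] show ?thesis by simp
  qed
  have S: "?S \<in> sets borel"
    by measurable
  have "emeasure (gauss p 0) ?S \<le> ennreal (2 / y / sqrt (2 * pi) * sqrt ((norm h)\<^sup>2 * p))"
  proof (rule emeasure_gauss_fibre_le [OF linear_outer [of h] norm_outer _ p _ S])
    fix P :: real and G :: "real^'n^'n" and m :: "real^'n"
    assume P: "0 < P"
    \<comment> \<open>The direction \<open>t\<close> depends on the base point \<open>G\<close> of
      the fibre but not on \<open>c\<close>: a normalised kernel vector if \<open>B + G\<close> is
      singular, otherwise the normalised solution of \<open>(B + G) *v z = h\<close>.\<close>
    obtain t \<beta> where t: "norm t = 1" "(B + G) *v t = \<beta> *\<^sub>R h"
    proof (cases "det (B + G) = 0")
      case True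
      then obtain x where "x \<noteq> 0" "(B + G) *v x = 0"
        by (auto simp: det_eq_0_iff_ker)
      then have "norm ((1 / norm x) *\<^sub>R x) = 1" "(B + G) *v ((1 / norm x) *\<^sub>R x) = 0 *\<^sub>R h"
        by (simp_all add: matrix_vector_mult_scaleR)
      then show ?thesis by (rule that)
    next
      case False
      define z where "z = cramer_solution (B + G) h"
      have z: "(B + G) *v z = h" unfolding z_def by (rule cramer_solution_eq [OF False])
      with h have "z \<noteq> 0" by auto
      then have "norm ((1 / norm z) *\<^sub>R z) = 1" "(B + G) *v ((1 / norm z) *\<^sub>R z) = (1 / norm z) *\<^sub>R h"
        by (simp_all add: matrix_vector_mult_scaleR z)
      then show ?thesis by (rule that)
    qed
    \<comment> \<open>Adding \<open>outer h c\<close> keeps the image of \<open>t\<close> on the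
      line through \<open>h\<close> and changes its coefficient to
      \<open>\<beta> + c \<bullet> t\<close>. Injectivity then makes the unit vector
      \<open>t\<close> this coefficient times the solution, so a solution of norm at least
      \<open>y\<close> forces a coefficient of size at most \<open>1 / y\<close>.\<close>
    have sub: "{c. G + outer h c \<in> ?S} \<subseteq> {c. \<bar>\<beta> + c \<bullet> t\<bar> \<le> 1 / y}"
    proof safe
      fix c assume nz: "det (B + (G + outer h c)) \<noteq> 0" and le: "y \<le> norm (cramer_solution (B + (G + outer h c)) h)"
      let ?A = "B + (G + outer h c)" and ?b = "\<beta> + c \<bullet> t"
      have "?A *v t = ?b *\<^sub>R h"
        using t by (simp add: matrix_vector_mult_add_rdistrib outer_mult_vec scaleR_left_distrib)
      also have "\<dots> = ?A *v (?b *\<^sub>R cramer_solution ?A h)"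
        by (simp add: matrix_vector_mult_scaleR cramer_solution_eq(1) [OF nz])
      finally have "t = ?b *\<^sub>R cramer_solution ?A h"
        using inj_matrix_vector_mult [of ?A] nz by (simp add: invertible_det_nz inj_eq)
      then have "1 = \<bar>?b\<bar> * norm (cramer_solution ?A h)"
        using t by (metis norm_scaleR)
      then have "\<bar>?b\<bar> * y \<le> 1"
        using le by (metis abs_ge_zero mult_left_mono)
      then show "\<bar>?b\<bar> \<le> 1 / y" using y by (simp add: field_simps)
    qed
    have "emeasure (gauss P m) {c. G + outer h c \<in> ?S} \<le> emeasure (gauss P m) {c. \<bar>\<beta> + c \<bullet> t\<bar> \<le> 1 / y}"
      by (rule emeasure_mono [OF sub]) simp
    also have "\<dots> \<le> ennreal ((2 / y) * sqrt (P / (2 * pi)))"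
    proof (rule emeasure_gauss_line_sections_le [OF t(1) P])
      fix v
      have "{s. v + s *\<^sub>R t \<in> {c. \<bar>\<beta> + c \<bullet> t\<bar> \<le> 1 / y}} = {- (\<beta> + v \<bullet> t) - 1 / y .. - (\<beta> + v \<bullet> t) + 1 / y}"
        using t(1) by (auto simp: inner_simps norm_eq_1)
      then show "emeasure lborel {s. v + s *\<^sub>R t \<in> {c. \<bar>\<beta> + c \<bullet> t\<bar> \<le> 1 / y}} \<le> ennreal (2 / y)"
        using y by simp
    qed (use y in auto)
    also have "(2 / y) * sqrt (P / (2 * pi)) = 2 / y / sqrt (2 * pi) * sqrt P"
      by (simp add: real_sqrt_divide)
    finally show "emeasure (gauss P m) {c. G + outer h c \<in> ?S} \<le> ennreal (2 / y / sqrt (2 * pi) * sqrt P)" .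
  qed (use y in auto)
  then show ?thesis by (simp add: real_sqrt_mult real_sqrt_divide mult_ac)
qed

section \<open>The norm of the inverse\<close>

lemma nn_integral_gauss_norm_square:
  "(\<integral>\<^sup>+h. ennreal ((norm h)\<^sup>2) \<partial>gauss 1 (0::'a::euclidean_space)) = ennreal (real DIM('a))"
proof -
  have one: "(\<integral>\<^sup>+x. ennreal (std_normal_density x) \<partial>lborel) = 1"
    by (subst nn_integral_eq_integral) auto
  have two: "(\<integral>\<^sup>+x. ennreal (x\<^sup>2 * std_normal_density x) \<partial>lborel) = 1"
    using std_normal_moment_even [of 1]
    by (subst nn_integral_eq_integral) (auto simp: mult.commute has_bochner_integral_iff fact_numeral)
  have "(\<integral>\<^sup>+h. ennreal ((norm h)\<^sup>2) \<partial>gauss 1 (0::'a))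
      = (\<integral>\<^sup>+h. ennreal (gauss_density 1 (0::'a) h) * ennreal ((norm h)\<^sup>2) \<partial>lborel)"
    by (rule nn_integral_gauss) simp
  \<comment> \<open>In the summand for \<open>b\<close>, the square is attached to the factor with
    index \<open>b\<close> alone, so each summand is a product of functions of single coordinates
    and its integral factorises.\<close>
  also have "\<dots> = (\<integral>\<^sup>+h. (\<Sum>b\<in>(Basis::'a set). \<Prod>b'\<in>Basis. ennreal ((if b' = b then (h \<bullet> b')\<^sup>2 else 1) * std_normal_density (h \<bullet> b'))) \<partial>lborel)"
  proof (rule nn_integral_cong)
    fix h :: 'a
    have "gauss_density 1 0 h * (norm h)\<^sup>2 = (\<Sum>b\<in>Basis. (h \<bullet> b)\<^sup>2 * (\<Prod>b'\<in>Basis. std_normal_density (h \<bullet> b')))"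
      unfolding power2_norm_eq_inner euclidean_inner [of h h]
      by (simp add: gauss_density_eq_prod power2_eq_square sum_distrib_left mult_ac)
    also have "\<dots> = (\<Sum>b\<in>Basis. \<Prod>b'\<in>Basis. (if b' = b then (h \<bullet> b')\<^sup>2 else 1) * std_normal_density (h \<bullet> b'))"
      by (intro sum.cong) (auto simp: prod.distrib prod.delta)
    finally show "ennreal (gauss_density 1 0 h) * ennreal ((norm h)\<^sup>2)
        = (\<Sum>b\<in>Basis. \<Prod>b'\<in>Basis. ennreal ((if b' = b then (h \<bullet> b')\<^sup>2 else 1) * std_normal_density (h \<bullet> b')))"
      by (simp add: ennreal_mult [symmetric] prod_ennreal sum_ennreal prod_nonneg)
  qed
  also have "\<dots> = (\<Sum>b\<in>(Basis::'a set). \<Prod>b'\<in>(Basis::'a set). \<integral>\<^sup>+x. ennreal ((if b' = b then x\<^sup>2 else 1) * std_normal_density x) \<partial>lborel)"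
    by (subst nn_integral_sum, measurable, intro sum.cong refl nn_integral_lborel_prod) auto
  also have "\<dots> = (\<Sum>b\<in>(Basis::'a set). \<Prod>b'\<in>(Basis::'a set). 1)"
  proof (intro sum.cong prod.cong refl)
    fix b b' :: 'a
    show "(\<integral>\<^sup>+x. ennreal ((if b' = b then x\<^sup>2 else 1) * std_normal_density x) \<partial>lborel) = 1"
      by (cases "b' = b") (simp_all only: if_True if_False mult_1 one two simp_thms)
  qed
  finally show ?thesis by (simp add: ennreal_of_nat_eq_real_of_nat)
qed

text \<open>With \<open>r\<close> the square root of the dimension,
  \<open>(norm h - r)\<^sup>2 \<ge> 0\<close> bounds the norm by an affine function of its square,
  whose mean is exactly \<open>r\<close>.\<close>

lemma nn_integral_gauss_norm_le:
  "(\<integral>\<^sup>+h. ennreal (norm h) \<partial>gauss 1 (0::'a::euclidean_space)) \<le> ennreal (sqrt (real DIM('a)))"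
proof -
  interpret prob_space "gauss 1 (0::'a)" by (rule prob_space_gauss) simp
  define r where "r = sqrt (real DIM('a))"
  have r: "0 < r" "r\<^sup>2 = real DIM('a)" by (auto simp: r_def)
  have "(\<integral>\<^sup>+h. ennreal (norm h) \<partial>gauss 1 (0::'a))
      \<le> (\<integral>\<^sup>+h. ennreal (1 / (2 * r)) * ennreal ((norm h)\<^sup>2) + ennreal (r / 2) \<partial>gauss 1 (0::'a))"
  proof (rule nn_integral_mono)
    fix h :: 'a
    have "0 \<le> (norm h - r)\<^sup>2" by simp
    then have "norm h \<le> 1 / (2 * r) * (norm h)\<^sup>2 + r / 2"
      using r(1) by (simp add: power2_eq_square field_simps)
    then show "ennreal (norm h) \<le> ennreal (1 / (2 * r)) * ennreal ((norm h)\<^sup>2) + ennreal (r / 2)"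
      using r(1) by (simp add: ennreal_mult [symmetric] ennreal_plus [symmetric] ennreal_leI del: ennreal_plus)
  qed
  also have "\<dots> = ennreal (1 / (2 * r)) * ennreal (real DIM('a)) + ennreal (r / 2)"
    using emeasure_space_1
    by (subst nn_integral_add) (auto simp: nn_integral_cmult nn_integral_gauss_norm_square)
  also have "\<dots> = ennreal r"
    using r(1) unfolding r(2) [symmetric]
    by (simp add: ennreal_mult [symmetric] ennreal_plus [symmetric] power2_eq_square field_simps del: ennreal_plus)
  finally show ?thesis by (simp add: r_def)
qed

text \<open>The unit sphere is compact and nonempty, so the continuous function
  \<open>norm (A *v u)\<close> has a maximum there.\<close>

lemma spectral_norm_attained:
  fixes A :: "real^'n^'m"
  obtains u where "norm u = 1" "norm (A *v u) = spectral_norm A"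
proof -
  have bl: "bounded_linear ((*v) A)" by simp
  have "sphere (0::real^'n) 1 \<noteq> {}" by simp
  moreover have "continuous_on (sphere 0 1) (\<lambda>u. norm (A *v u))"
    by (intro continuous_intros)
  ultimately obtain u where u: "u \<in> sphere 0 1" "\<And>v. v \<in> sphere 0 1 \<Longrightarrow> norm (A *v v) \<le> norm (A *v u)"
    using continuous_attains_sup [of "sphere 0 1" "\<lambda>u. norm (A *v u)"] by auto
  have "norm (A *v v) \<le> norm (A *v u) * norm v" for v
  proof (cases "v = 0")
    case False
    then have "norm (A *v ((1 / norm v) *\<^sub>R v)) \<le> norm (A *v u)" by (intro u) simp
    then show ?thesis using False by (simp add: matrix_vector_mult_scaleR field_simps)
  qed simp
  then have "spectral_norm A \<le> norm (A *v u)"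
    unfolding spectral_norm_def by (intro onorm_bound) auto
  moreover have "norm (A *v u) \<le> spectral_norm A"
    using onorm [OF bl, of u] u(1) by (simp add: spectral_norm_def)
  ultimately show ?thesis using u(1) that [of u] by simp
qed

lemma norm_matrix_vector_le: "norm (A *v v) \<le> spectral_norm A * norm v"
  for A :: "real^'n^'m"
  unfolding spectral_norm_def by (rule onorm) simp

lemma spectral_norm_nonneg: "0 \<le> spectral_norm A" for A :: "real^'n^'m"
  unfolding spectral_norm_def by (rule onorm_pos_le) simp

text \<open>If \<open>w\<close> is the unit vector along \<open>A *v u\<close> for a maximising
  \<open>u\<close>, the row vector \<open>w v* A\<close> has norm at least
  \<open>spectral_norm A\<close>, and its inner product with \<open>h\<close> is
  \<open>w \<bullet> (A *v h)\<close>. So \<open>norm (A *v h)\<close> is bounded below through one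
  coordinate of \<open>h\<close>.\<close>

lemma spectral_norm_left_direction:
  fixes A :: "real^'n^'m"
  assumes "0 < spectral_norm A"
  obtains z where "norm z = 1" "\<And>h. spectral_norm A * \<bar>h \<bullet> z\<bar> \<le> norm (A *v h)"
proof -
  obtain u where u: "norm u = 1" "norm (A *v u) = spectral_norm A"
    by (rule spectral_norm_attained)
  define w where "w = (1 / spectral_norm A) *\<^sub>R (A *v u)"
  define z where "z = w v* A"
  have w: "norm w = 1" using assms u by (simp add: w_def)
  have zh: "z \<bullet> h = w \<bullet> (A *v h)" for h
    by (simp add: z_def dot_lmul_matrix)
  have "spectral_norm A = z \<bullet> u"
    unfolding zh using assms u(2) by (simp add: w_def power2_norm_eq_inner [symmetric] power2_eq_square)
  also have "\<dots> \<le> norm z" using norm_cauchy_schwarz [of z u] u(1) by simp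
  finally have le: "spectral_norm A \<le> norm z" .
  then have "z \<noteq> 0" using assms by auto
  show ?thesis
  proof
    show "norm ((1 / norm z) *\<^sub>R z) = 1" using \<open>z \<noteq> 0\<close> by simp
    fix h
    have "spectral_norm A * \<bar>h \<bullet> ((1 / norm z) *\<^sub>R z)\<bar> \<le> norm z * \<bar>h \<bullet> ((1 / norm z) *\<^sub>R z)\<bar>"
      using le by (intro mult_right_mono) auto
    also have "\<dots> = \<bar>w \<bullet> (A *v h)\<bar>"
      using \<open>z \<noteq> 0\<close> by (simp add: zh [symmetric] inner_commute abs_mult)
    also have "\<dots> \<le> norm (A *v h)"
      using Cauchy_Schwarz_ineq2 [of w "A *v h"] w by simp
    finally show "spectral_norm A * \<bar>h \<bullet> ((1 / norm z) *\<^sub>R z)\<bar> \<le> norm (A *v h)" .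
  qed
qed

lemma spectral_norm_triangle:
  fixes A B :: "real^'n^'m"
  shows "spectral_norm (A + B) \<le> spectral_norm A + spectral_norm B"
  unfolding spectral_norm_def matrix_vector_mult_add_rdistrib by (rule onorm_triangle) simp_all

text \<open>Tonelli's theorem for measures on the Borel sets. Second countability identifies the
  product of the two Borel algebras with the Borel algebra of the product, so joint Borel
  measurability suffices.\<close>

lemma nn_integral_swap_borel:
  fixes M :: "'a::second_countable_topology measure" and N :: "'b::second_countable_topology measure"
  assumes M: "sigma_finite_measure M" "sets M = sets borel" and N: "sigma_finite_measure N" "sets N = sets borel"
    and f: "(\<lambda>(x, y). f x y) \<in> borel_measurable borel"
  shows "(\<integral>\<^sup>+x. \<integral>\<^sup>+y. f x y \<partial>N \<partial>M) = (\<integral>\<^sup>+y. \<integral>\<^sup>+x. f x y \<partial>M \<partial>N)"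
    and "(\<lambda>x. \<integral>\<^sup>+y. f x y \<partial>N) \<in> borel_measurable borel"
proof -
  interpret M: sigma_finite_measure M by (rule M)
  interpret N: sigma_finite_measure N by (rule N)
  interpret pair_sigma_finite N M ..
  have "sets (N \<Otimes>\<^sub>M M) = sets (borel \<Otimes>\<^sub>M borel)"
    using M N by (intro sets_pair_measure_cong) simp_all
  moreover have "(\<lambda>(y, x). f x y) \<in> borel_measurable (borel \<Otimes>\<^sub>M borel)"
    using f by (subst measurable_pair_swap_iff) (simp add: borel_prod)
  ultimately show "(\<integral>\<^sup>+x. \<integral>\<^sup>+y. f x y \<partial>N \<partial>M) = (\<integral>\<^sup>+y. \<integral>\<^sup>+x. f x y \<partial>M \<partial>N)"
    by (subst Fubini') (simp_all cong: measurable_cong_sets)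
  have "sets (borel \<Otimes>\<^sub>M N) = sets (borel \<Otimes>\<^sub>M borel)"
    using N by (intro sets_pair_measure_cong) simp_all
  then have "(\<lambda>(x, y). f x y) \<in> borel_measurable (borel \<Otimes>\<^sub>M N)"
    using f by (subst measurable_cong_sets [OF _ refl]) (assumption, simp add: borel_prod)
  then show "(\<lambda>x. \<integral>\<^sup>+y. f x y \<partial>N) \<in> borel_measurable borel"
    by (rule N.borel_measurable_nn_integral)
qed

lemma sigma_finite_gauss: "0 < p \<Longrightarrow> sigma_finite_measure (gauss p m)"
  using prob_space_gauss [of p m] by (rule prob_space_imp_sigma_finite)

text \<open>Fubini exchanges a fixed \<open>G\<close> with random \<open>h\<close> for a fixed
  \<open>h\<close> with random \<open>G\<close>, where the tail bound for a fixed vector applies.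
  The event is enclosed in a Borel set \<open>S\<close>, so only \<open>S\<close> has to be
  measured.\<close>

lemma inverse_norm_tail:
  fixes B :: "real^'n^'n"
  assumes p: "0 < p" and Y: "0 < Y"
  obtains S where "S \<in> sets borel"
    "\<And>G. det (B + G) \<noteq> 0 \<Longrightarrow> Y \<le> spectral_norm (matrix_inv (B + G)) \<Longrightarrow> G \<in> S"
    "emeasure (gauss p 0) S \<le> ennreal (8 * sqrt (real CARD('n)) * sqrt p / (pi * Y))"
proof -
  \<comment> \<open>Chosen so that a standard normal variable lies in \<open>[-s, s]\<close> with
    probability at most \<open>2 * s / sqrt (2 * pi) = 1 / 2\<close>.\<close>
  define s where "s = sqrt (2 * pi) / 4"
  have s: "0 < s" by (simp add: s_def)
  define D where "D G h \<longleftrightarrow> det (B + G) \<noteq> 0 \<and> s * Y \<le> norm (cramer_solution (B + G) h)" for G h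
  have cs: "(\<lambda>z. cramer_solution (B + fst z) (snd z)) \<in> borel_measurable borel"
  proof -
    have "(\<lambda>z. (B + fst z, snd z)) \<in> borel_measurable borel"
      by (intro borel_measurable_continuous_onI continuous_intros)
    from measurable_compose [OF this cramer_solution_measurable] show ?thesis by simp
  qed
  have dm: "(\<lambda>z. det (B + fst z)) \<in> borel_measurable (borel :: ((real^'n^'n) \<times> (real^'n)) measure)"
    by (intro borel_measurable_continuous_onI continuous_intros)
  have "{z. det (B + fst z) \<noteq> 0 \<and> s * Y \<le> norm (cramer_solution (B + fst z) (snd z))} \<in> sets borel"
    using cs dm by measurable
  then have D: "{(G, h). D G h} \<in> sets borel" by (simp add: D_def case_prod_unfold)
  then have Dm: "(\<lambda>(G, h). indicator {(G, h). D G h} (G, h) :: ennreal) \<in> borel_measurable borel"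
    by (simp add: case_prod_unfold)
  have D': "{(G, h). D G h} \<in> sets (borel \<Otimes>\<^sub>M borel)" unfolding borel_prod by (rule D)
  have sec: "{h. D G h} \<in> sets borel" for G
  proof -
    have "Pair G -` {(G, h). D G h} \<in> sets borel"
      using D' by (rule sets_Pair1)
    then show ?thesis by (simp add: vimage_def)
  qed
  have sec': "{G. D G h} \<in> sets borel" for h
  proof -
    have "(\<lambda>G. (G, h)) -` {(G, h). D G h} \<in> sets borel"
      using D' by (rule sets_Pair2)
    then show ?thesis by (simp add: vimage_def)
  qed
  define \<psi> where "\<psi> G = emeasure (gauss 1 (0::real^'n)) {h. D G h}" for G
  have \<psi>_eq: "\<psi> G = (\<integral>\<^sup>+h. indicator {(G, h). D G h} (G, h) \<partial>gauss 1 (0::real^'n))" for G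
  proof -
    have "(\<integral>\<^sup>+h. indicator {(G, h). D G h} (G, h) \<partial>gauss 1 (0::real^'n)) = (\<integral>\<^sup>+h. indicator {h. D G h} h \<partial>gauss 1 (0::real^'n))"
      by (intro nn_integral_cong) (auto split: split_indicator)
    then show ?thesis using sec by (simp add: \<psi>_def)
  qed
  have \<psi>m: "\<psi> \<in> borel_measurable borel"
    unfolding \<psi>_eq [abs_def]
    by (rule nn_integral_swap_borel(2) [OF sigma_finite_gauss [OF p, of 0] _ sigma_finite_gauss _ Dm]) simp_all
  have int: "(\<integral>\<^sup>+G. \<psi> G \<partial>gauss p 0) \<le> ennreal (4 * sqrt (real CARD('n)) * sqrt p / (pi * Y))"
  proof -
    have "(\<integral>\<^sup>+G. \<psi> G \<partial>gauss p 0)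
        = (\<integral>\<^sup>+h. \<integral>\<^sup>+G. indicator {(G, h). D G h} (G, h) \<partial>gauss p 0 \<partial>gauss 1 (0::real^'n))"
      unfolding \<psi>_eq
      by (rule nn_integral_swap_borel(1) [OF sigma_finite_gauss [OF p] _ sigma_finite_gauss _ Dm]) simp_all
    also have "\<dots> \<le> (\<integral>\<^sup>+h. ennreal (2 / (s * Y) * sqrt (p / (2 * pi))) * ennreal (norm h) \<partial>gauss 1 (0::real^'n))"
    proof (rule nn_integral_mono)
      fix h :: "real^'n"
      have "(\<integral>\<^sup>+G. indicator {(G, h). D G h} (G, h) \<partial>gauss p 0) = (\<integral>\<^sup>+G. indicator {G. D G h} G \<partial>gauss p 0)"
        by (intro nn_integral_cong) (auto split: split_indicator)
      also have "\<dots> = emeasure (gauss p 0) {G. D G h}" using sec' by simp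
      also have "\<dots> \<le> ennreal (2 * norm h / (s * Y) * sqrt (p / (2 * pi)))"
        unfolding D_def using s Y by (intro emeasure_inverse_vector_le p) simp
      also have "\<dots> = ennreal (2 / (s * Y) * sqrt (p / (2 * pi))) * ennreal (norm h)"
        using s Y p by (simp add: ennreal_mult [symmetric])
      finally show "(\<integral>\<^sup>+G. indicator {(G, h). D G h} (G, h) \<partial>gauss p 0) \<le> \<dots>" .
    qed
    also have "\<dots> \<le> ennreal (2 / (s * Y) * sqrt (p / (2 * pi))) * ennreal (sqrt (real CARD('n)))"
      using nn_integral_gauss_norm_le [where 'a = "real^'n"]
      by (subst nn_integral_cmult) (auto intro!: mult_left_mono)
    also have "\<dots> = ennreal (2 / (s * Y) * sqrt (p / (2 * pi)) * sqrt (real CARD('n)))"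
      using s Y p by (subst ennreal_mult) auto
    \<comment> \<open>The choice of \<open>s\<close> turns \<open>2 / (s * sqrt (2 * pi))\<close>
      into \<open>4 / pi\<close>; Markov's inequality at level \<open>1 / 2\<close> doubles this
      below.\<close>
    also have "2 / (s * Y) * sqrt (p / (2 * pi)) * sqrt (real CARD('n)) = 4 * sqrt (real CARD('n)) * sqrt p / (pi * Y)"
      using Y by (simp add: s_def real_sqrt_divide field_simps)
    finally show ?thesis .
  qed
  show ?thesis
  proof
    show "{G. 1 \<le> 2 * \<psi> G} \<in> sets borel"
      using \<psi>m by measurable
    have "emeasure (gauss p 0) {G. 1 \<le> 2 * \<psi> G} = emeasure (gauss p 0) {G \<in> UNIV. 1 \<le> 2 * \<psi> G}"
      by simp
    also have "\<dots> \<le> 2 * (\<integral>\<^sup>+G. \<psi> G * indicator UNIV G \<partial>gauss p 0)"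
      using \<psi>m by (intro nn_integral_Markov_inequality) auto
    also have "\<dots> \<le> 2 * ennreal (4 * sqrt (real CARD('n)) * sqrt p / (pi * Y))"
      using int by (intro mult_left_mono) auto
    also have "\<dots> = ennreal (8 * sqrt (real CARD('n)) * sqrt p / (pi * Y))"
      using Y p by (subst ennreal_numeral [symmetric], subst ennreal_mult [symmetric]) auto
    finally show "emeasure (gauss p 0) {G. 1 \<le> 2 * \<psi> G} \<le> ennreal (8 * sqrt (real CARD('n)) * sqrt p / (pi * Y))" .
  next
    fix G
    assume nz: "det (B + G) \<noteq> 0" and le: "Y \<le> spectral_norm (matrix_inv (B + G))"
    interpret prob_space "gauss 1 (0::real^'n)" by (rule prob_space_gauss) simp
    obtain z where z: "norm z = 1"
      "\<And>h. spectral_norm (matrix_inv (B + G)) * \<bar>h \<bullet> z\<bar> \<le> norm (matrix_inv (B + G) *v h)"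
      using spectral_norm_left_direction [of "matrix_inv (B + G)"] le Y by auto
    \<comment> \<open>Outside \<open>D G\<close>, \<open>Y * \<bar>h \<bullet> z\<bar> \<le> norm
      (matrix_inv (B + G) *v h) < s * Y\<close>, so \<open>h\<close> lies in a slab of probability
      at most \<open>1 / 2\<close>. Hence \<open>\<psi> G \<ge> 1 / 2\<close>.\<close>
    have "UNIV - {h. D G h} \<subseteq> {h. \<bar>h \<bullet> z\<bar> \<le> s}"
    proof safe
      fix h assume "\<not> D G h"
      then have "norm (matrix_inv (B + G) *v h) < s * Y"
        using nz by (simp add: D_def cramer_solution_eq(2))
      then have "Y * \<bar>h \<bullet> z\<bar> < s * Y"
        using z(2) [of h] mult_right_mono [OF le, of "\<bar>h \<bullet> z\<bar>"] by linarith
      then show "\<bar>h \<bullet> z\<bar> \<le> s" using Y by (simp add: mult.commute)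
    qed
    then have "emeasure (gauss 1 0) (UNIV - {h. D G h}) \<le> emeasure (gauss 1 0) {h. \<bar>h \<bullet> z\<bar> \<le> s}"
      by (rule emeasure_mono) simp
    also have "\<dots> \<le> ennreal (2 * s * sqrt (1 / (2 * pi)))"
    proof (rule emeasure_gauss_line_sections_le [OF z(1)])
      fix v
      have "{t. v + t *\<^sub>R z \<in> {h. \<bar>h \<bullet> z\<bar> \<le> s}} = {- (v \<bullet> z) - s .. - (v \<bullet> z) + s}"
        using z(1) by (auto simp: inner_simps norm_eq_1)
      then show "emeasure lborel {t. v + t *\<^sub>R z \<in> {h. \<bar>h \<bullet> z\<bar> \<le> s}} \<le> ennreal (2 * s)"
        using s by simp
    qed (use s in auto)
    also have "2 * s * sqrt (1 / (2 * pi)) = 1 / 2"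
      by (simp add: s_def real_sqrt_divide)
    finally have "prob (UNIV - {h. D G h}) \<le> 1 / 2"
      unfolding emeasure_eq_measure by (subst (asm) ennreal_le_iff) simp_all
    then have "1 / 2 \<le> prob {h. D G h}"
      using prob_compl [of "{h. D G h}"] sec by simp
    then have "1 \<le> ennreal (2 * prob {h. D G h})"
      by (simp add: ennreal_leI flip: ennreal_1)
    also have "\<dots> = 2 * \<psi> G"
      by (simp add: \<psi>_def emeasure_eq_measure ennreal_mult)
    finally show "G \<in> {G. 1 \<le> 2 * \<psi> G}" by simp
  qed
qed

section \<open>The norm of a Gaussian matrix\<close>

text \<open>Completing the square: the exponential weight moves the mean to \<open>a / p\<close> and
  leaves the stated constant.\<close>

lemma nn_integral_gauss_exp_inner:
  fixes a :: "'a::euclidean_space"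
  assumes p: "0 < p"
  shows "(\<integral>\<^sup>+v. ennreal (exp (v \<bullet> a)) \<partial>gauss p 0) = ennreal (exp ((norm a)\<^sup>2 / (2 * p)))"
proof -
  have "(\<integral>\<^sup>+v. ennreal (exp (v \<bullet> a)) \<partial>gauss p 0)
      = (\<integral>\<^sup>+v. ennreal (gauss_density p 0 v) * ennreal (exp (v \<bullet> a)) \<partial>lborel)"
    by (rule nn_integral_gauss) simp
  also have "\<dots> = (\<integral>\<^sup>+v. ennreal (exp ((norm a)\<^sup>2 / (2 * p))) * ennreal (gauss_density p ((1 / p) *\<^sub>R a) v) \<partial>lborel)"
  proof (rule nn_integral_cong)
    fix v :: 'a
    have "(norm (v - (1 / p) *\<^sub>R a))\<^sup>2 = (norm v)\<^sup>2 - 2 / p * (v \<bullet> a) + (norm a)\<^sup>2 / p\<^sup>2"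
      unfolding power2_norm_eq_inner
      by (simp add: inner_simps inner_commute algebra_simps power2_eq_square)
    then have "- (p / 2) * (norm v)\<^sup>2 + v \<bullet> a = (norm a)\<^sup>2 / (2 * p) + - (p / 2) * (norm (v - (1 / p) *\<^sub>R a))\<^sup>2"
      using p by (simp add: field_simps power2_eq_square)
    then have "exp (- (p / 2) * (norm v)\<^sup>2) * exp (v \<bullet> a)
        = exp ((norm a)\<^sup>2 / (2 * p)) * exp (- (p / 2) * (norm (v - (1 / p) *\<^sub>R a))\<^sup>2)"
      unfolding exp_add [symmetric] by (rule arg_cong)
    then have "gauss_density p 0 v * exp (v \<bullet> a) = exp ((norm a)\<^sup>2 / (2 * p)) * gauss_density p ((1 / p) *\<^sub>R a) v"
      by (simp add: gauss_density_def)
    then show "ennreal (gauss_density p 0 v) * ennreal (exp (v \<bullet> a))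
        = ennreal (exp ((norm a)\<^sup>2 / (2 * p))) * ennreal (gauss_density p ((1 / p) *\<^sub>R a) v)"
      using p by (simp add: ennreal_mult [symmetric])
  qed
  also have "\<dots> = ennreal (exp ((norm a)\<^sup>2 / (2 * p)))"
    by (subst nn_integral_cmult) (auto simp: nn_integral_gauss_density [OF p])
  finally show ?thesis .
qed

text \<open>The weight lowers the precision from 1 to \<open>1 / 4\<close>, since
  \<open>- 1/2 + 3/8 = - 1/8\<close>; the normalising constants then differ by a factor 2 per
  dimension.\<close>

lemma nn_integral_gauss_exp_norm_square:
  "(\<integral>\<^sup>+w. ennreal (exp (3 / 8 * (norm w)\<^sup>2)) \<partial>gauss 1 (0::'a::euclidean_space)) = ennreal (2 ^ DIM('a))"
proof -
  have "(\<integral>\<^sup>+w. ennreal (exp (3 / 8 * (norm w)\<^sup>2)) \<partial>gauss 1 (0::'a))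
      = (\<integral>\<^sup>+w. ennreal (gauss_density 1 (0::'a) w) * ennreal (exp (3 / 8 * (norm w)\<^sup>2)) \<partial>lborel)"
    by (rule nn_integral_gauss) simp
  also have "\<dots> = (\<integral>\<^sup>+w. ennreal (2 ^ DIM('a)) * ennreal (gauss_density (1 / 4) (0::'a) w) \<partial>lborel)"
  proof (rule nn_integral_cong)
    fix w :: 'a
    have "sqrt (1 / (2 * pi)) = 2 * sqrt (1 / 4 / (2 * pi))"
      using real_sqrt_mult [of 4 "1 / 4 / (2 * pi)"] by simp
    then have "sqrt (1 / (2 * pi)) ^ DIM('a) = 2 ^ DIM('a) * sqrt (1 / 4 / (2 * pi)) ^ DIM('a)"
      by (simp add: power_mult_distrib)
    moreover have "exp (- (1 / 2) * (norm w)\<^sup>2) * exp (3 / 8 * (norm w)\<^sup>2) = exp (- (1 / 4 / 2) * (norm w)\<^sup>2)"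
      unfolding exp_add [symmetric] by (simp add: algebra_simps)
    ultimately have "gauss_density 1 0 w * exp (3 / 8 * (norm w)\<^sup>2) = 2 ^ DIM('a) * gauss_density (1 / 4) 0 w"
      by (simp add: gauss_density_def)
    then show "ennreal (gauss_density 1 0 w) * ennreal (exp (3 / 8 * (norm w)\<^sup>2))
        = ennreal (2 ^ DIM('a)) * ennreal (gauss_density (1 / 4) 0 w)"
      by (simp add: ennreal_mult [symmetric])
  qed
  also have "\<dots> = ennreal (2 ^ DIM('a))"
    by (subst nn_integral_cmult) (auto simp: nn_integral_gauss_density)
  finally show ?thesis .
qed

text \<open>The square in the exponent is linearised by an auxiliary standard Gaussian
  \<open>w\<close>: \<open>exp (3 / 8 * (norm (G *v v))\<^sup>2)\<close> is the mean of
  \<open>exp (w \<bullet> (k *\<^sub>R (G *v v)))\<close>, as \<open>k\<^sup>2 / 2 = 3 / 8\<close>.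
  The new exponent is linear in \<open>G\<close>, so after exchanging integrals both means are
  explicit.\<close>

lemma nn_integral_gauss_exp_image_le:
  fixes v :: "real^'n"
  assumes p: "1 \<le> p" and v: "norm v \<le> 1"
  shows "(\<integral>\<^sup>+G. ennreal (exp (3 / 8 * (norm (G *v v))\<^sup>2)) \<partial>gauss p (0::real^'n^'m)) \<le> ennreal (2 ^ CARD('m))"
proof -
  have p0: "0 < p" using p by simp
  define k :: real where "k = sqrt (3 / 4)"
  have k2: "k\<^sup>2 = 3 / 4" by (simp add: k_def)
  have "(\<integral>\<^sup>+G. ennreal (exp (3 / 8 * (norm (G *v v))\<^sup>2)) \<partial>gauss p (0::real^'n^'m))
      = (\<integral>\<^sup>+G. \<integral>\<^sup>+w. ennreal (exp (w \<bullet> (k *\<^sub>R (G *v v)))) \<partial>gauss 1 0 \<partial>gauss p (0::real^'n^'m))"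
    by (subst nn_integral_gauss_exp_inner) (simp_all add: power_mult_distrib k2)
  also have "\<dots> = (\<integral>\<^sup>+w. \<integral>\<^sup>+G. ennreal (exp (w \<bullet> (k *\<^sub>R (G *v v)))) \<partial>gauss p (0::real^'n^'m) \<partial>gauss 1 0)"
  proof (rule nn_integral_swap_borel(1) [OF sigma_finite_gauss [OF p0] _ sigma_finite_gauss])
    have "continuous_on UNIV (\<lambda>z :: (real^'n^'m) \<times> (real^'m). exp (snd z \<bullet> (k *\<^sub>R (fst z *v v))))"
      unfolding matrix_vector_mult_def by (intro continuous_intros)
    then have "(\<lambda>z :: (real^'n^'m) \<times> (real^'m). exp (snd z \<bullet> (k *\<^sub>R (fst z *v v)))) \<in> borel_measurable borel"
      by (rule borel_measurable_continuous_onI)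
    then show "(\<lambda>(G :: real^'n^'m, w). ennreal (exp (w \<bullet> (k *\<^sub>R (G *v v))))) \<in> borel_measurable borel"
      unfolding case_prod_unfold by measurable
  qed simp_all
  also have "\<dots> = (\<integral>\<^sup>+w. \<integral>\<^sup>+G. ennreal (exp (G \<bullet> outer (k *\<^sub>R w) v)) \<partial>gauss p (0::real^'n^'m) \<partial>gauss 1 0)"
    by (simp add: inner_outer)
  also have "\<dots> \<le> (\<integral>\<^sup>+w. ennreal (exp (3 / 8 * (norm w)\<^sup>2)) \<partial>gauss 1 (0::real^'m))"
  proof (rule nn_integral_mono)
    fix w :: "real^'m"
    have "(norm w)\<^sup>2 * (norm v)\<^sup>2 \<le> (norm w)\<^sup>2 * p"
      using v p by (intro mult_left_mono) (auto intro: order_trans [OF power_le_one])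
    then have "(norm (outer (k *\<^sub>R w) v))\<^sup>2 / (2 * p) \<le> 3 / 8 * (norm w)\<^sup>2"
      using p0 by (simp add: norm_outer power_mult_distrib k2 field_simps)
    then show "(\<integral>\<^sup>+G. ennreal (exp (G \<bullet> outer (k *\<^sub>R w) v)) \<partial>gauss p (0::real^'n^'m)) \<le> ennreal (exp (3 / 8 * (norm w)\<^sup>2))"
      by (simp add: nn_integral_gauss_exp_inner [OF p0] ennreal_leI)
  qed
  also have "\<dots> = ennreal (2 ^ CARD('m))"
    using nn_integral_gauss_exp_norm_square [where 'a = "real^'m"] by simp
  finally show ?thesis .
qed

text \<open>If \<open>u\<close> is a unit vector with \<open>norm (G *v u) = spectral_norm G\<close>, then \<open>norm (G *v v)\<close> is at
  least \<open>3/4 * spectral_norm G\<close> on the ball of radius \<open>1/8\<close> around \<open>7/8 * u\<close>, which lies in the unit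
  ball. So averaging \<open>exp (3/8 * norm (G *v v) ^ 2)\<close> over \<open>v\<close> in the unit ball replaces a net argument.\<close>

lemma gauss_spectral_norm_tail:
  assumes p: "1 \<le> p" and M: "0 \<le> M"
  obtains S :: "(real^'n^'n) set" where "S \<in> sets borel"
    "\<And>G. M \<le> spectral_norm G \<Longrightarrow> G \<in> S"
    "emeasure (gauss p 0) S \<le> ennreal (16 ^ CARD('n) * exp (- (27 / 128) * M\<^sup>2))"
proof -
  have p0: "0 < p" using p by simp
  define V where "V = unit_ball_vol (real CARD('n))"
  have V: "0 < V" by (simp add: V_def)
  define f where "f G v = ennreal (exp (3 / 8 * (norm (G *v v))\<^sup>2)) * indicator (cball 0 1) v"
    for G :: "real^'n^'n" and v
  have fm: "(\<lambda>(G, v). f G v) \<in> borel_measurable borel"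
  proof -
    have "continuous_on UNIV (\<lambda>z :: (real^'n^'n) \<times> (real^'n). 3 / 8 * (norm (fst z *v snd z))\<^sup>2)"
      unfolding matrix_vector_mult_def by (intro continuous_intros)
    then have 1: "(\<lambda>z :: (real^'n^'n) \<times> (real^'n). exp (3 / 8 * (norm (fst z *v snd z))\<^sup>2)) \<in> borel_measurable borel"
      by (intro borel_measurable_continuous_onI continuous_on_exp)
    have 2: "snd \<in> borel_measurable (borel :: ((real^'n^'n) \<times> (real^'n)) measure)"
      by (intro borel_measurable_continuous_onI continuous_intros)
    have 3: "(\<lambda>z. indicator (cball 0 1) (snd z) :: ennreal) \<in> borel_measurable (borel :: ((real^'n^'n) \<times> (real^'n)) measure)"
      by (rule measurable_compose [OF 2]) (auto intro!: borel_measurable_indicator)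
    show ?thesis
      unfolding case_prod_unfold f_def
      by (intro borel_measurable_times_ennreal measurable_compose [OF 1 measurable_ennreal] 3)
  qed
  define \<Phi> where "\<Phi> G = (\<integral>\<^sup>+v. f G v \<partial>lborel)" for G
  have \<Phi>m: "\<Phi> \<in> borel_measurable borel"
    unfolding \<Phi>_def [abs_def]
    by (rule nn_integral_swap_borel(2) [OF sigma_finite_gauss [OF p0, of 0] _ sigma_finite_lborel _ fm]) simp_all
  have "(\<integral>\<^sup>+G. \<Phi> G \<partial>gauss p 0) = (\<integral>\<^sup>+v. \<integral>\<^sup>+G. f G v \<partial>gauss p 0 \<partial>lborel)"
    unfolding \<Phi>_def
    by (rule nn_integral_swap_borel(1) [OF sigma_finite_gauss [OF p0] _ sigma_finite_lborel _ fm]) simp_all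
  also have "\<dots> \<le> (\<integral>\<^sup>+v. ennreal (2 ^ CARD('n)) * indicator (cball (0::real^'n) 1) v \<partial>lborel)"
  proof (rule nn_integral_mono)
    fix v :: "real^'n"
    show "(\<integral>\<^sup>+G. f G v \<partial>gauss p 0) \<le> ennreal (2 ^ CARD('n)) * indicator (cball 0 1) v"
      unfolding f_def using nn_integral_gauss_exp_image_le [OF p, of v, where 'm = 'n]
      by (cases "norm v \<le> 1") simp_all
  qed
  also have "\<dots> = ennreal (2 ^ CARD('n)) * ennreal V"
    by (subst nn_integral_cmult_indicator) (simp_all add: emeasure_cball V_def)
  also have "\<dots> = ennreal (2 ^ CARD('n) * V)"
    using V by (simp add: ennreal_mult)
  finally have int: "(\<integral>\<^sup>+G. \<Phi> G \<partial>gauss p 0) \<le> ennreal (2 ^ CARD('n) * V)" .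
  \<comment> \<open>The volume of a ball of radius \<open>1 / 8\<close> times the lower bound of the
    integrand there, with \<open>27 / 128 = 3 / 8 * (3 / 4)\<^sup>2\<close>. Dividing the mean bound
    \<open>2 ^ n * V\<close> by \<open>b\<close> yields the factor \<open>16 ^ n\<close>.\<close>
  define b where "b = V * (1 / 8) ^ CARD('n) * exp (27 / 128 * M\<^sup>2)"
  have b: "0 < b" using V by (simp add: b_def)
  show ?thesis
  proof
    show "{G. 1 \<le> ennreal (1 / b) * \<Phi> G} \<in> sets borel"
      using \<Phi>m by measurable
    have "emeasure (gauss p 0) {G. 1 \<le> ennreal (1 / b) * \<Phi> G} = emeasure (gauss p 0) {G \<in> UNIV. 1 \<le> ennreal (1 / b) * \<Phi> G}"
      by simp
    also have "\<dots> \<le> ennreal (1 / b) * (\<integral>\<^sup>+G. \<Phi> G * indicator UNIV G \<partial>gauss p 0)"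
      using \<Phi>m by (intro nn_integral_Markov_inequality) auto
    also have "\<dots> \<le> ennreal (1 / b) * ennreal (2 ^ CARD('n) * V)"
      using int by (intro mult_left_mono) auto
    also have "\<dots> = ennreal (1 / b * (2 ^ CARD('n) * V))"
      using b V by (subst ennreal_mult) auto
    also have "1 / b * (2 ^ CARD('n) * V) = 16 ^ CARD('n) * exp (- (27 / 128) * M\<^sup>2)"
      using V by (simp add: b_def exp_minus field_simps flip: power_mult_distrib)
    finally show "emeasure (gauss p 0) {G. 1 \<le> ennreal (1 / b) * \<Phi> G} \<le> \<dots>" .
  next
    fix G :: "real^'n^'n"
    assume le: "M \<le> spectral_norm G"
    obtain u where u: "norm u = 1" "norm (G *v u) = spectral_norm G"
      by (rule spectral_norm_attained)
    have "ennreal b = (\<integral>\<^sup>+v. ennreal (exp (27 / 128 * M\<^sup>2)) * indicator (cball ((7 / 8) *\<^sub>R u) (1 / 8)) v \<partial>lborel)"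
      using V by (subst nn_integral_cmult_indicator) (simp_all add: b_def emeasure_cball V_def ennreal_mult [symmetric] mult_ac)
    also have "\<dots> \<le> \<Phi> G"
      unfolding \<Phi>_def
    proof (rule nn_integral_mono)
      fix v
      show "ennreal (exp (27 / 128 * M\<^sup>2)) * indicator (cball ((7 / 8) *\<^sub>R u) (1 / 8)) v \<le> f G v"
      proof (cases "v \<in> cball ((7 / 8) *\<^sub>R u) (1 / 8)")
        case True
        then have d: "norm (v - (7 / 8) *\<^sub>R u) \<le> 1 / 8" by (simp add: dist_norm norm_minus_commute)
        have v1: "norm v \<le> 1"
          using norm_triangle_sub [of v "(7 / 8) *\<^sub>R u"] d u(1) by simp
        have "norm (v - u) \<le> norm (v - (7 / 8) *\<^sub>R u) + norm ((7 / 8) *\<^sub>R u - u)"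
          using norm_triangle_ineq [of "v - (7 / 8) *\<^sub>R u" "(7 / 8) *\<^sub>R u - u"] by simp
        also have "(7 / 8) *\<^sub>R u - u = (- (1 / 8)) *\<^sub>R u"
          using scaleR_diff_left [of "7 / 8" 1 u] by simp
        finally have "norm (v - u) \<le> 1 / 4" using d u(1) by simp
        then have "norm (G *v (v - u)) \<le> spectral_norm G * (1 / 4)"
          using norm_matrix_vector_le [of G "v - u"] spectral_norm_nonneg [of G]
          by (meson mult_left_mono order_trans)
        moreover have "norm (G *v u) \<le> norm (G *v v) + norm (G *v (v - u))"
          unfolding matrix_vector_mult_diff_distrib using norm_triangle_sub [of "G *v u" "G *v v"]
          by (simp add: norm_minus_commute)
        ultimately have "3 / 4 * M \<le> norm (G *v v)" using le u(2) by simp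
        then have "(3 / 4 * M)\<^sup>2 \<le> (norm (G *v v))\<^sup>2" using M by (intro power_mono) auto
        then have "27 / 128 * M\<^sup>2 \<le> 3 / 8 * (norm (G *v v))\<^sup>2" by (simp add: power2_eq_square)
        then show ?thesis using v1 True by (simp add: f_def ennreal_leI)
      qed simp
    qed
    finally have "ennreal (1 / b) * ennreal b \<le> ennreal (1 / b) * \<Phi> G"
      by (rule mult_left_mono) simp
    then show "G \<in> {G. 1 \<le> ennreal (1 / b) * \<Phi> G}"
      using b by (simp add: ennreal_mult [symmetric])
  qed
qed

section \<open>The law of a Gaussian perturbation\<close>

text \<open>Both measures agree on open boxes, where independence gives a product of one-dimensional
  probabilities, and boxes form an intersection-stable generator of the Borel sets. The bijection
  \<open>e\<close> lets independence be indexed by any set, such as pairs of matrix indices.\<close>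

lemma (in prob_space) indep_vars_distr_gauss:
  fixes G :: "'a \<Rightarrow> 'b::euclidean_space"
  assumes p: "0 < p"
    and e: "bij_betw e I Basis"
    and dist: "\<And>i. i \<in> I \<Longrightarrow> distributed M lborel (\<lambda>\<omega>. G \<omega> \<bullet> e i) (normal_density 0 (1 / sqrt p))"
    and indep: "indep_vars (\<lambda>_. borel) (\<lambda>i \<omega>. G \<omega> \<bullet> e i) I"
  shows "G \<in> borel_measurable M" "distr M borel G = gauss p 0"
proof -
  let ?d = "\<lambda>x. ennreal (normal_density 0 (1 / sqrt p) x)"
  have img: "Basis = e ` I" using e by (simp add: bij_betw_def)
  then have "I \<noteq> {}" using nonempty_Basis by auto
  have "finite I" using e bij_betw_finite finite_Basis by blast
  have rv: "(\<lambda>\<omega>. G \<omega> \<bullet> b) \<in> borel_measurable M" if "b \<in> Basis" for b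
    using distributed_measurable [OF dist] that by (auto simp: img)
  then show Gm [measurable]: "G \<in> borel_measurable M"
    by (subst borel_measurable_euclidean_space) auto
  let ?E = "range (\<lambda>(a, b). box a b :: 'b set)"
  let ?A = "\<lambda>n::nat. box (- (real n *\<^sub>R One)) (real n *\<^sub>R One) :: 'b set"
  show "distr M borel G = gauss p 0"
  proof (rule measure_eqI_generator_eq)
    show "Int_stable ?E"
      by (auto simp: Int_stable_def box_Int_box)
    show "?E \<subseteq> Pow UNIV" "sets (distr M borel G) = sigma_sets UNIV ?E" "sets (gauss p (0::'b)) = sigma_sets UNIV ?E"
      by (simp_all add: borel_eq_box)
    show "range ?A \<subseteq> ?E" "(\<Union>i. ?A i) = UNIV"
      unfolding UN_box_eq_UNIV by auto
    show "emeasure (distr M borel G) (?A i) \<noteq> \<infinity>" for i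
      by (subst emeasure_distr) auto
    fix X assume "X \<in> ?E"
    then obtain l u where X: "X = box l u" by auto
    have "emeasure (distr M borel G) X = emeasure M (G -` X \<inter> space M)"
      by (subst emeasure_distr) (auto simp: X)
    also have "G -` X \<inter> space M = {\<omega> \<in> space M. \<forall>b\<in>Basis. G \<omega> \<bullet> b \<in> {l \<bullet> b <..< u \<bullet> b}}"
      by (auto simp: X mem_box)
    also have "emeasure M \<dots> = ennreal (prob {\<omega> \<in> space M. \<forall>b\<in>Basis. G \<omega> \<bullet> b \<in> {l \<bullet> b <..< u \<bullet> b}})"
      by (rule emeasure_eq_measure)
    also have "{\<omega> \<in> space M. \<forall>b\<in>Basis. G \<omega> \<bullet> b \<in> {l \<bullet> b <..< u \<bullet> b}}
        = (\<Inter>i\<in>I. (\<lambda>\<omega>. G \<omega> \<bullet> e i) -` {l \<bullet> e i <..< u \<bullet> e i} \<inter> space M)"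
      using \<open>I \<noteq> {}\<close> by (auto simp: img)
    also have "prob \<dots> = (\<Prod>i\<in>I. prob ((\<lambda>\<omega>. G \<omega> \<bullet> e i) -` {l \<bullet> e i <..< u \<bullet> e i} \<inter> space M))"
      by (rule indep_varsD_finite [OF indep \<open>I \<noteq> {}\<close> \<open>finite I\<close>]) auto
    also have "ennreal \<dots> = (\<Prod>i\<in>I. emeasure M ((\<lambda>\<omega>. G \<omega> \<bullet> e i) -` {l \<bullet> e i <..< u \<bullet> e i} \<inter> space M))"
      by (simp add: emeasure_eq_measure prod_ennreal)
    also have "\<dots> = (\<Prod>i\<in>I. \<integral>\<^sup>+x. ?d x * indicator {l \<bullet> e i <..< u \<bullet> e i} x \<partial>lborel)"
      by (intro prod.cong refl distributed_emeasure dist) auto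
    also have "\<dots> = (\<Prod>b\<in>Basis. \<integral>\<^sup>+x. ?d x * indicator {l \<bullet> b <..< u \<bullet> b} x \<partial>lborel)"
      by (rule prod.reindex_bij_betw [OF e])
    also have "\<dots> = (\<integral>\<^sup>+v. (\<Prod>b\<in>Basis. ?d (v \<bullet> b) * indicator {l \<bullet> b <..< u \<bullet> b} (v \<bullet> b)) \<partial>lborel)"
      by (subst nn_integral_lborel_prod) auto
    also have "\<dots> = (\<integral>\<^sup>+v. ennreal (gauss_density p 0 v) * indicator X v \<partial>lborel)"
    proof (rule nn_integral_cong)
      fix v :: 'b
      have "(\<Prod>b\<in>Basis. indicator {l \<bullet> b <..< u \<bullet> b} (v \<bullet> b) :: ennreal) = indicator X v"
        by (cases "v \<in> X") (force simp: X mem_box indicator_def)+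
      then show "(\<Prod>b\<in>Basis. ?d (v \<bullet> b) * indicator {l \<bullet> b <..< u \<bullet> b} (v \<bullet> b)) = ennreal (gauss_density p 0 v) * indicator X v"
        using p by (simp add: prod.distrib gauss_density_eq_prod prod_ennreal)
    qed
    also have "\<dots> = emeasure (gauss p 0) X"
      unfolding gauss_def by (subst emeasure_density) (auto simp: X)
    finally show "emeasure (distr M borel G) X = emeasure (gauss p 0) X" .
  qed
qed

lemma gaussian_perturbation_distr:
  fixes Abar :: "real^'n^'m" and A :: "'w \<Rightarrow> real^'n^'m"
  assumes M: "prob_space M" and \<sigma>: "0 < \<sigma>" and gp: "gaussian_perturbation M \<sigma> Abar A"
  obtains G where "\<And>\<omega>. \<omega> \<in> space M \<Longrightarrow> A \<omega> = Abar + G \<omega>"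
    "G \<in> borel_measurable M" "distr M borel G = gauss (1 / \<sigma>\<^sup>2) 0"
proof -
  interpret prob_space M by (rule M)
  obtain G where A: "\<And>\<omega>. \<omega> \<in> space M \<Longrightarrow> A \<omega> = Abar + G \<omega>"
    and d: "\<And>i j. distributed M lborel (\<lambda>\<omega>. G \<omega> $ i $ j) (normal_density 0 \<sigma>)"
    and ind: "indep_vars (\<lambda>_. borel) (\<lambda>(i, j) \<omega>. G \<omega> $ i $ j) UNIV"
    using gp unfolding gaussian_perturbation_def by blast
  \<comment> \<open>The matrix units, indexed by entry positions, are exactly the
    \<open>Basis\<close> of the matrix space.\<close>
  define e :: "'m \<times> 'n \<Rightarrow> real^'n^'m" where "e = (\<lambda>(i, j). axis i (axis j 1))"
  have "bij_betw e UNIV Basis"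
    by (auto simp: bij_betw_def inj_on_def e_def Basis_vec_def axis_eq_axis)
  moreover have comp: "G \<omega> \<bullet> e z = (case z of (i, j) \<Rightarrow> G \<omega> $ i $ j)" for z \<omega>
    by (simp add: e_def case_prod_unfold inner_axis)
  moreover have "distributed M lborel (\<lambda>\<omega>. G \<omega> \<bullet> e z) (normal_density 0 (1 / sqrt (1 / \<sigma>\<^sup>2)))" for z
    using d \<sigma> by (simp add: comp case_prod_unfold real_sqrt_divide)
  moreover have "indep_vars (\<lambda>_. borel) (\<lambda>z \<omega>. G \<omega> \<bullet> e z) UNIV"
    using ind by (simp add: comp case_prod_unfold)
  ultimately show ?thesis
    using that [OF A] indep_vars_distr_gauss [of "1 / \<sigma>\<^sup>2" e UNIV G] \<sigma> by auto
qed

section \<open>The condition number\<close>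

text \<open>Dropping the cross term, \<open>M\<^sup>2 \<ge> 14 * n + 6 * ln x\<close>, because
  \<open>(19 / 5)\<^sup>2 > 14\<close> and \<open>2 * (7 / 4)\<^sup>2 > 6\<close>. The first part
  beats \<open>16 ^ n\<close>, since \<open>exp (27 * 14 / 128) \<ge> 16\<close>; the second gives
  \<open>1 / x\<close>, since \<open>27 * 6 / 128 > 1\<close>.\<close>

lemma norm_tail_numeric:
  fixes x :: real and n :: nat
  assumes n: "1 \<le> n" and x: "1 \<le> x"
    and M: "M = 19 / 5 * sqrt (real n) + 7 / 4 * sqrt (2 * ln x)"
  shows "16 ^ n * exp (- (27 / 128) * M\<^sup>2) \<le> 1 / x"
proof -
  define r l where "r = sqrt (real n)" and "l = sqrt (2 * ln x)"
  have r: "0 \<le> r" "r\<^sup>2 = real n" and l: "0 \<le> l" "l\<^sup>2 = 2 * ln x" using x by (simp_all add: r_def l_def)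
  have "14 * real n + 6 * ln x \<le> (19 / 5 * r)\<^sup>2 + (7 / 4 * l)\<^sup>2"
    using ln_ge_zero [OF x] of_nat_0_le_iff [of n, where 'a = real]
    unfolding power_mult_distrib r(2) l(2) by (simp add: power_divide)
  also have "\<dots> \<le> M\<^sup>2"
    unfolding M r_def [symmetric] l_def [symmetric] using r l by (simp add: power2_sum)
  finally have "(27 / 128) * (14 * real n + 6 * ln x) \<le> 27 / 128 * M\<^sup>2" by simp
  moreover have "0 \<le> ln x" using x by simp
  ultimately have "- (27 / 128) * M\<^sup>2 \<le> real n * (- (27 * 14 / 128)) + - ln x" by simp
  then have "exp (- (27 / 128) * M\<^sup>2) \<le> exp (real n * (- (27 * 14 / 128)) + - ln x)" by simp
  also have "\<dots> = exp (- (27 * 14 / 128)) ^ n * (1 / x)"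
    unfolding exp_add exp_of_nat_mult using x by (simp add: exp_minus inverse_eq_divide)
  finally have "16 ^ n * exp (- (27 / 128) * M\<^sup>2) \<le> 16 ^ n * (exp (- (27 * 14 / 128)) ^ n * (1 / x))"
    by (rule mult_left_mono) simp
  also have "\<dots> = (16 * exp (- (27 * 14 / 128))) ^ n * (1 / x)"
    by (simp add: power_mult_distrib)
  also have "\<dots> \<le> 1 * (1 / x)"
  proof (intro mult_right_mono power_le_one)
    \<comment> \<open>A rational lower bound for the exponential; 32 factors are enough to exceed
      16.\<close>
    have "(1 + 27 * 14 / 128 / real 32) ^ 32 \<le> exp (27 * 14 / 128 :: real)"
      by (rule exp_ge_one_plus_x_over_n_power_n) simp_all
    moreover have "(16::real) \<le> (1 + 27 * 14 / 128 / real 32) ^ 32"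
      by (simp add: power_divide)
    ultimately have "16 \<le> exp (27 * 14 / 128 :: real)" by linarith
    then show "16 * exp (- (27 * 14 / 128 :: real)) \<le> 1" by (simp add: exp_minus field_simps)
  qed (use x in auto)
  finally show ?thesis by simp
qed

lemma combined_bound_numeric:
  fixes x \<sigma> :: real and n :: nat
  assumes n: "1 \<le> n" and x: "1 \<le> x" and \<sigma>: "0 < \<sigma>" "\<sigma> \<le> 1"
    and K: "K = 24 / 5 * sqrt (real n) + 7 / 4 * sqrt (2 * ln x)"
  shows "1 / x + 8 * sqrt (real n) * (1 / \<sigma>) / (pi * (x / K))
    \<le> 14.1 * real n * (1 + sqrt (2 * ln x / (9 * real n))) / (x * \<sigma>)"
proof -
  define r l where "r = sqrt (real n)" and "l = sqrt (2 * ln x)"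
  have r: "1 \<le> r" "r\<^sup>2 = real n" and l: "0 \<le> l" using x n by (simp_all add: r_def l_def)
  have K': "K = 24 / 5 * r + 7 / 4 * l" by (simp add: K r_def l_def)
  have K0: "0 < K" unfolding K' using r l by simp
  have sq: "sqrt (2 * ln x / (9 * real n)) = l / (3 * r)"
    by (simp add: r_def l_def real_sqrt_divide real_sqrt_mult)
  have "8 / pi \<le> 8 / 3" using pi_gt3 by (simp add: field_simps)
  then have "8 / pi * (r * K) \<le> 8 / 3 * (r * K)"
    using r K0 by (intro mult_right_mono) auto
  also have "\<dots> = 12.8 * r\<^sup>2 + 14 / 3 * (r * l)"
    by (simp add: K' power2_eq_square algebra_simps)
  finally have "\<sigma> + 8 / pi * (r * K) \<le> 1 + 12.8 * r\<^sup>2 + 14 / 3 * (r * l)" using \<sigma> by simp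
  \<comment> \<open>The gap \<open>14.1 - 12.8 = 1.3\<close> absorbs the 1 that came from
    \<open>\<sigma> \<le> 1\<close>, because \<open>r\<^sup>2 \<ge> 1\<close>; and
    \<open>14 / 3 \<le> 4.7 = 14.1 / 3\<close>.\<close>
  also have "\<dots> \<le> 14.1 * r\<^sup>2 + 4.7 * (r * l)"
  proof -
    have "1 \<le> r\<^sup>2" using r(1) by (rule one_le_power)
    moreover have "0 \<le> r * l" using r(1) l by simp
    ultimately show ?thesis by linarith
  qed
  also have "\<dots> = 14.1 * r\<^sup>2 * (1 + l / (3 * r))"
    using r(1) by (simp add: field_simps power2_eq_square)
  finally have main: "\<sigma> + 8 / pi * (r * K) \<le> 14.1 * r\<^sup>2 * (1 + l / (3 * r))" .
  have "1 / x + 8 * sqrt (real n) * (1 / \<sigma>) / (pi * (x / K)) = (\<sigma> + 8 / pi * (r * K)) / (x * \<sigma>)"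
    unfolding r_def [symmetric] using x \<sigma> K0 by (simp add: field_simps)
  also have "\<dots> \<le> 14.1 * r\<^sup>2 * (1 + l / (3 * r)) / (x * \<sigma>)"
    using main x \<sigma> by (intro divide_right_mono) auto
  finally show ?thesis unfolding sq r(2) .
qed

theorem theorem3p1:
  fixes M :: "'w measure"
    and Abar :: "real^'n^'n"
    and A :: "'w \<Rightarrow> real^'n^'n"
    and \<sigma> x :: real
  assumes "prob_space M"
    and "spectral_norm Abar \<le> sqrt (real CARD('n))"
    and "0 < \<sigma>"
    and "\<sigma>\<^sup>2 \<le> 1"
    and "gaussian_perturbation M \<sigma> Abar A"
    and "1 \<le> x"
  shows "measure M {\<omega> \<in> space M. x \<le> condition_number (A \<omega>)}
    \<le> 14.1 * real CARD('n) * (1 + sqrt (2 * ln x / (9 * real CARD('n)))) / (x * \<sigma>)"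
proof -
  interpret prob_space M by (rule assms)
  obtain G where A: "\<And>\<omega>. \<omega> \<in> space M \<Longrightarrow> A \<omega> = Abar + G \<omega>"
    and Gm [measurable]: "G \<in> borel_measurable M" and distr: "distr M borel G = gauss (1 / \<sigma>\<^sup>2) 0"
    using gaussian_perturbation_distr assms by blast
  define p where "p = 1 / \<sigma>\<^sup>2"
  have p: "1 \<le> p" "0 < p" "sqrt p = 1 / \<sigma>"
    using assms by (simp_all add: p_def real_sqrt_divide)
  have \<sigma>1: "\<sigma> \<le> 1" using assms by (simp add: power_le_one_iff)
  define n where "n = CARD('n)"
  have n: "1 \<le> n" by (simp add: n_def Suc_le_eq)
  define L where "L = 19 / 5 * sqrt (real n) + 7 / 4 * sqrt (2 * ln x)"
  \<comment> \<open>\<open>K = sqrt n + L\<close> bounds the norm of \<open>A\<close> when the norm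
    of \<open>G\<close> is below \<open>L\<close>, as \<open>Abar\<close> contributes at most
    \<open>sqrt n\<close>.\<close>
  define K where "K = 24 / 5 * sqrt (real n) + 7 / 4 * sqrt (2 * ln x)"
  have L0: "0 \<le> L" using assms by (simp add: L_def)
  have K0: "0 < K" using n assms by (simp add: K_def add_pos_nonneg)
  have x0: "0 < x" using assms by simp
  obtain S1 :: "(real^'n^'n) set" where S1 [measurable]: "S1 \<in> sets borel"
    and S1': "\<And>G. L \<le> spectral_norm G \<Longrightarrow> G \<in> S1"
    and S1'': "emeasure (gauss p 0) S1 \<le> ennreal (16 ^ CARD('n) * exp (- (27 / 128) * L\<^sup>2))"
    using gauss_spectral_norm_tail [OF p(1) L0] by blast
  obtain S2 where S2 [measurable]: "S2 \<in> sets borel"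
    and S2': "\<And>G. det (Abar + G) \<noteq> 0 \<Longrightarrow> x / K \<le> spectral_norm (matrix_inv (Abar + G)) \<Longrightarrow> G \<in> S2"
    and S2'': "emeasure (gauss p 0) S2 \<le> ennreal (8 * sqrt (real CARD('n)) * sqrt p / (pi * (x / K)))"
    using inverse_norm_tail [OF p(2), of "x / K" Abar] x0 K0 by (metis divide_pos_pos)
  \<comment> \<open>For singular \<open>A \<omega>\<close> the value of \<open>matrix_inv\<close> is
    unspecified, so these outcomes are put into a null set.\<close>
  define S3 where "S3 = {G. det (Abar + G) = 0}"
  have S3 [measurable]: "S3 \<in> sets borel" unfolding S3_def by measurable
  have S3'': "emeasure (gauss p 0) S3 = 0"
    unfolding S3_def by (rule singular_null [OF p(2)])
  have "{\<omega> \<in> space M. x \<le> condition_number (A \<omega>)} \<subseteq> G -` (S1 \<union> S2 \<union> S3) \<inter> space M"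
  proof
    fix \<omega>
    assume "\<omega> \<in> {\<omega> \<in> space M. x \<le> condition_number (A \<omega>)}"
    then have \<omega>: "\<omega> \<in> space M" and cn: "x \<le> condition_number (A \<omega>)" by auto
    \<comment> \<open>Off \<open>S1\<close> the norm of \<open>A \<omega>\<close> is at most
      \<open>K\<close>, so a condition number of at least \<open>x\<close> forces the inverse to
      have norm at least \<open>x / K\<close>.\<close>
    have "G \<omega> \<in> S2" if n1: "G \<omega> \<notin> S1" and n3: "G \<omega> \<notin> S3"
    proof -
      have "spectral_norm (G \<omega>) < L" using S1' n1 by (meson not_le)
      then have "spectral_norm (A \<omega>) \<le> sqrt (real n) + L"
        using spectral_norm_triangle [of Abar "G \<omega>"] assms(2) A [OF \<omega>] by (simp add: n_def)
      also have "\<dots> = K" by (simp add: K_def L_def)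
      finally have "spectral_norm (A \<omega>) * spectral_norm (matrix_inv (A \<omega>)) \<le> K * spectral_norm (matrix_inv (A \<omega>))"
        by (intro mult_right_mono spectral_norm_nonneg)
      then have "x / K \<le> spectral_norm (matrix_inv (Abar + G \<omega>))"
        using cn K0 A [OF \<omega>] by (simp add: condition_number_def field_simps)
      with n3 show ?thesis by (intro S2') (simp_all add: S3_def)
    qed
    then show "\<omega> \<in> G -` (S1 \<union> S2 \<union> S3) \<inter> space M" using \<omega> by blast
  qed
  then have "emeasure M {\<omega> \<in> space M. x \<le> condition_number (A \<omega>)} \<le> emeasure M (G -` (S1 \<union> S2 \<union> S3) \<inter> space M)"
    by (rule emeasure_mono) measurable
  also have "\<dots> = emeasure (gauss p 0) (S1 \<union> S2 \<union> S3)"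
    unfolding p_def distr [symmetric] by (subst emeasure_distr) auto
  also have "\<dots> \<le> emeasure (gauss p 0) S1 + emeasure (gauss p 0) S2 + emeasure (gauss p 0) S3"
    by (intro order_trans [OF emeasure_subadditive] add_right_mono emeasure_subadditive) auto
  also have "\<dots> \<le> ennreal (1 / x) + ennreal (8 * sqrt (real n) * (1 / \<sigma>) / (pi * (x / K))) + 0"
    using S1'' S2'' norm_tail_numeric [OF n assms(6) L_def]
    by (intro add_mono) (auto simp: n_def S3'' p(3) intro: order_trans ennreal_leI)
  also have "\<dots> = ennreal (1 / x + 8 * sqrt (real n) * (1 / \<sigma>) / (pi * (x / K)))"
    using x0 K0 assms(3) by (simp add: ennreal_plus)
  finally have "measure M {\<omega> \<in> space M. x \<le> condition_number (A \<omega>)} \<le> 1 / x + 8 * sqrt (real n) * (1 / \<sigma>) / (pi * (x / K))"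
    unfolding emeasure_eq_measure using x0 K0 assms(3) by (subst (asm) ennreal_le_iff) auto
  also have "\<dots> \<le> 14.1 * real n * (1 + sqrt (2 * ln x / (9 * real n))) / (x * \<sigma>)"
    by (rule combined_bound_numeric [OF n assms(6,3) \<sigma>1 K_def])
  finally show ?thesis by (simp add: n_def)
qed

end
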